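(* For any $m,n\in\mathbb{N}$ and $\epsilon>0$, given samples of a pair of distributions $X,Y$ over $\{0,1\}^n$ that each have support size at most $m$, one can distinguish (with probability at least $2/3$ of correct output) between the case that $X$ and $Y$ are identical and the case that they are $\epsilon$-far from one another, using $\widetilde{O}(m^{2/3}/\epsilon^3)$ queries and $O(m^{2/3}/\epsilon^2)$ samples (from each distribution). Furthermore, the same holds even if only the support size of one of the two distributions is upper-bounded by $m$.
   Context: For $x,y\in\{0,1\}^n$ let $\Delta_H(x,y)=\frac1n|\{i:x_i\neq y_i\}|$. The distance between distributions $X,Y$ over $\{0,1\}^n$ is $\min\sum_{x,y}w_{x,y}\Delta_H(x,y)$ over nonnegative $w_{x,y}$ with $\sum_y w_{x,y}=\Pr[X=x]$ and $\sum_x w_{x,y}=\Pr[Y=y]$; they are $\epsilon$-far if this exceeds $\epsilon$. The algorithm has oracle access to independent samples of $X$ and of $Y$ and may query individual bits of each sample; queries count the total number of bits queried. *)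

theory Defs
  imports "HOL-Probability.Probability" "HOL-Probability.Product_PMF"
begin

definition cube :: "nat \<Rightarrow> bool list set" where
  "cube n = {x. length x = n}"

text \<open>For \<open>n = 0\<close> the division by zero yields distance 0, as it should on a one-point space.\<close>

definition rel_hamming :: "nat \<Rightarrow> bool list \<Rightarrow> bool list \<Rightarrow> real" where
  "rel_hamming n x y = real (card {i. i < n \<and> x ! i \<noteq> y ! i}) / real n"

definition transport_plan ::
  "nat \<Rightarrow> bool list pmf \<Rightarrow> bool list pmf \<Rightarrow> (bool list \<Rightarrow> bool list \<Rightarrow> real) \<Rightarrow> bool" where
  "transport_plan n X Y w \<longleftrightarrow>
     (\<forall>x\<in>cube n. \<forall>y\<in>cube n. 0 \<le> w x y) \<and>
     (\<forall>x\<in>cube n. (\<Sum>y\<in>cube n. w x y) = pmf X x) \<and>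
     (\<forall>y\<in>cube n. (\<Sum>x\<in>cube n. w x y) = pmf Y y)"

text \<open>The infimum is a minimum: the plans, restricted to the finite set
  \<open>cube n \<times> cube n\<close>, form a nonempty compact polytope on which the cost is linear.\<close>

definition emd :: "nat \<Rightarrow> bool list pmf \<Rightarrow> bool list pmf \<Rightarrow> real" where
  "emd n X Y =
     (INF w\<in>{w. transport_plan n X Y w}. \<Sum>x\<in>cube n. \<Sum>y\<in>cube n. w x y * rel_hamming n x y)"

definition eps_far :: "nat \<Rightarrow> real \<Rightarrow> bool list pmf \<Rightarrow> bool list pmf \<Rightarrow> bool" where
  "eps_far n \<epsilon> X Y \<longleftrightarrow> emd n X Y > \<epsilon>"

datatype source = FromX | FromY

text \<open>A deterministic adaptive algorithm. \<open>Query c j i t0 t1\<close> reads bit \<open>i\<close> of the \<open>j\<close>-th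
  sample of the distribution \<open>c\<close> and continues with \<open>t0\<close> or \<open>t1\<close> if that bit is 0 or 1.
  \<open>Answer True\<close> means ``identical''. A randomized algorithm is a distribution over such
  trees, i.e. its internal coins are tossed in advance.\<close>

datatype query_tree =
    Answer bool
  | Query source nat nat query_tree query_tree

primrec verdict :: "query_tree \<Rightarrow> (nat \<Rightarrow> bool list) \<Rightarrow> (nat \<Rightarrow> bool list) \<Rightarrow> bool" where
  "verdict (Answer b) xs ys = b"
| "verdict (Query c j i t0 t1) xs ys =
     (if (case c of FromX \<Rightarrow> xs j ! i | FromY \<Rightarrow> ys j ! i)
      then verdict t1 xs ys else verdict t0 xs ys)"

primrec max_queries :: "query_tree \<Rightarrow> nat" where
  "max_queries (Answer b) = 0"
| "max_queries (Query c j i t0 t1) = Suc (max (max_queries t0) (max_queries t1))"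

text \<open>All queries address one of the \<open>s\<close> samples of each distribution, and one of its \<open>n\<close> bits.\<close>

primrec well_formed :: "nat \<Rightarrow> nat \<Rightarrow> query_tree \<Rightarrow> bool" where
  "well_formed n s (Answer b) \<longleftrightarrow> True"
| "well_formed n s (Query c j i t0 t1) \<longleftrightarrow>
     j < s \<and> i < n \<and> well_formed n s t0 \<and> well_formed n s t1"

text \<open>The coins, the \<open>s\<close> samples of \<open>X\<close> and the \<open>s\<close> samples of \<open>Y\<close> are all independent.\<close>

definition run ::
  "query_tree pmf \<Rightarrow> nat \<Rightarrow> bool list pmf \<Rightarrow> bool list pmf \<Rightarrow> bool pmf" where
  "run A s X Y =
     bind_pmf A (\<lambda>t.
     bind_pmf (Pi_pmf {..<s} [] (\<lambda>_. X)) (\<lambda>xs.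
     bind_pmf (Pi_pmf {..<s} [] (\<lambda>_. Y)) (\<lambda>ys.
     return_pmf (verdict t xs ys))))"

definition uses_at_most :: "nat \<Rightarrow> nat \<Rightarrow> nat \<Rightarrow> query_tree pmf \<Rightarrow> bool" where
  "uses_at_most n s q A \<longleftrightarrow> (\<forall>t\<in>set_pmf A. well_formed n s t \<and> max_queries t \<le> q)"

text \<open>\<open>P\<close> is the promise on the pair of distributions.\<close>

definition distinguishes ::
  "nat \<Rightarrow> real \<Rightarrow> nat \<Rightarrow> (bool list pmf \<Rightarrow> bool list pmf \<Rightarrow> bool) \<Rightarrow> query_tree pmf \<Rightarrow> bool" where
  "distinguishes n \<epsilon> s P A \<longleftrightarrow>
     (\<forall>X Y. set_pmf X \<subseteq> cube n \<longrightarrow> set_pmf Y \<subseteq> cube n \<longrightarrow> P X Y \<longrightarrow>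
        (X = Y \<longrightarrow> pmf (run A s X Y) True \<ge> 2 / 3) \<and>
        (eps_far n \<epsilon> X Y \<longrightarrow> pmf (run A s X Y) False \<ge> 2 / 3))"

text \<open>The bounds hidden in soft-O notation: \<open>f\<close> times a power of \<open>log f\<close>, up to a constant.
  The summand 2 keeps the logarithm away from 0 for small \<open>f\<close>.\<close>

definition soft_bound :: "real \<Rightarrow> nat \<Rightarrow> real \<Rightarrow> real" where
  "soft_bound C k f = C * f * ln (2 + f) ^ k"

end

theory Submission
  imports Defs
begin

text \<open>Choose \<open>l = O(log (m / \<epsilon>) / \<epsilon>)\<close> random positions and read only these bits of every sample.
  If, say, \<open>X\<close> has at most \<open>m\<close> support points, then for most choices and for all but an
  \<open>\<epsilon>/4\<close>-fraction of \<open>Y\<close>, no point of the support of \<open>X\<close> at distance more than \<open>\<epsilon>/2\<close> collides with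
  the \<open>Y\<close>-point on the chosen positions. A coupling of the restrictions \<open>p, q\<close> then lifts to a
  cheap transport plan, so \<open>\<epsilon>\<close>-far distributions have restrictions at total variation distance at
  least \<open>\<epsilon>/4\<close>.

  Closeness of \<open>p\<close> and \<open>q\<close> is tested by a weighted \<open>l\<^sub>2\<close>-statistic. About \<open>m\<^bsup>2/3\<^esup>\<close> samples of
  each distribution define the weight \<open>u a = 1 / (1 + N a)\<close>, where \<open>N a\<close> counts the occurrences of
  \<open>a\<close>; these are the buckets of the flattening technique, averaged out. The expected weighted norm
  \<open>\<Sum>a. u a * (p a\<^sup>2 + q a\<^sup>2)\<close> is then \<open>O(m\<^bsup>-2/3\<^esup>)\<close>, whereas by Cauchy-Schwarz the weighted distance
  \<open>\<Sum>a. u a * (p a - q a)\<^sup>2\<close> is \<open>\<Omega>(\<epsilon>\<^sup>2 / m)\<close> in the far case. With \<open>S, S'\<close> the count differences on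
  two fresh blocks of \<open>r\<close> samples, \<open>\<Sum>a. u a * S a * S' a\<close> has \<open>r\<^sup>2\<close> times this distance as its mean,
  and Chebyshev's inequality separates the two cases once \<open>r\<close> is of order \<open>m\<^bsup>2/3\<^esup> / \<epsilon>\<^sup>2\<close>.\<close>

subsection \<open>Moments of independent samples\<close>

lemma expectation_pair_pmf_finite:
  fixes h :: "'a \<times> 'b \<Rightarrow> real"
  assumes "finite (set_pmf p)" "finite (set_pmf q)"
  shows "measure_pmf.expectation (pair_pmf p q) h =
    measure_pmf.expectation p (\<lambda>a. measure_pmf.expectation q (\<lambda>b. h (a, b)))"
proof -
  have "measure_pmf.expectation (pair_pmf p q) h =
      (\<Sum>z\<in>set_pmf p \<times> set_pmf q. h z * pmf (pair_pmf p q) z)"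
    using assms by (intro integral_measure_pmf_real) auto
  also have "\<dots> = (\<Sum>a\<in>set_pmf p. \<Sum>b\<in>set_pmf q. h (a, b) * (pmf p a * pmf q b))"
    by (simp add: sum.cartesian_product' pmf_pair split_def)
  also have "\<dots> = (\<Sum>a\<in>set_pmf p. (\<Sum>b\<in>set_pmf q. h (a, b) * pmf q b) * pmf p a)"
    by (simp add: sum_distrib_left sum_distrib_right mult_ac)
  also have "\<dots> = (\<Sum>a\<in>set_pmf p. measure_pmf.expectation q (\<lambda>b. h (a, b)) * pmf p a)"
    by (intro sum.cong refl arg_cong2[where f = "(*)"] integral_measure_pmf_real[symmetric])
      (use assms in auto)
  also have "\<dots> = measure_pmf.expectation p (\<lambda>a. measure_pmf.expectation q (\<lambda>b. h (a, b)))"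
    by (intro integral_measure_pmf_real[symmetric]) (use assms in auto)
  finally show ?thesis .
qed

lemma finite_set_Pi_pmf:
  assumes "finite I" "\<And>i. i \<in> I \<Longrightarrow> finite (set_pmf (p i))"
  shows "finite (set_pmf (Pi_pmf I d p))"
  using assms by (auto simp: set_Pi_pmf)

text \<open>Multiplied out, the product has \<open>card I\<close> diagonal terms and
  \<open>(card I)^2 - card I\<close> terms with two distinct, hence independent, coordinates, whose
  expectation factorizes. The induction splits off one coordinate at a time.\<close>

lemma expectation_sum_mult_sum_Pi_pmf:
  fixes \<phi> \<psi> :: "'b \<Rightarrow> real"
  assumes "finite I" and fin: "finite (set_pmf p)"
  defines "E \<equiv> measure_pmf.expectation p"
  shows "measure_pmf.expectation (Pi_pmf I d (\<lambda>_. p)) (\<lambda>f. (\<Sum>i\<in>I. \<phi> (f i)) * (\<Sum>i\<in>I. \<psi> (f i)))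
    = real (card I) * E (\<lambda>z. \<phi> z * \<psi> z) + (real (card I) ^ 2 - real (card I)) * (E \<phi> * E \<psi>)"
  using \<open>finite I\<close>
proof (induction I rule: finite_induct)
  case empty
  then show ?case by simp
next
  case (insert j I)
  let ?M = "Pi_pmf I d (\<lambda>_. p)"
  have finM: "finite (set_pmf ?M)"
    using insert fin by (intro finite_set_Pi_pmf) auto
  note [simp] = integrable_measure_pmf_finite[OF fin] integrable_measure_pmf_finite[OF finM]
  have upd: "(\<Sum>i\<in>I. g ((f(j := y)) i)) = (\<Sum>i\<in>I. g (f i))" for g :: "'b \<Rightarrow> real" and f y
    using insert by (intro sum.cong) auto
  have lin: "measure_pmf.expectation ?M (\<lambda>f. \<Sum>i\<in>I. g (f i)) = real (card I) * E g"
    for g :: "'b \<Rightarrow> real"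
  proof -
    have "measure_pmf.expectation ?M (\<lambda>f. \<Sum>i\<in>I. g (f i)) =
        (\<Sum>i\<in>I. measure_pmf.expectation (map_pmf (\<lambda>f. f i) ?M) g)"
      by simp
    also have "\<dots> = (\<Sum>i\<in>I. E g)"
      using insert by (intro sum.cong refl) (simp add: Pi_pmf_component E_def del: integral_map_pmf)
    finally show ?thesis by simp
  qed
  have "measure_pmf.expectation (Pi_pmf (insert j I) d (\<lambda>_. p))
      (\<lambda>f. (\<Sum>i\<in>insert j I. \<phi> (f i)) * (\<Sum>i\<in>insert j I. \<psi> (f i))) =
    E (\<lambda>y. measure_pmf.expectation ?M
      (\<lambda>f. (\<phi> y + (\<Sum>i\<in>I. \<phi> (f i))) * (\<psi> y + (\<Sum>i\<in>I. \<psi> (f i)))))"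
    using insert finM fin unfolding E_def
    by (simp add: Pi_pmf_insert split_def upd expectation_pair_pmf_finite del: fun_upd_apply)
      (simp add: fun_upd_same)
  also have "\<dots> = E (\<lambda>y. \<phi> y * \<psi> y + \<phi> y * (real (card I) * E \<psi>) + \<psi> y * (real (card I) * E \<phi>) +
      measure_pmf.expectation ?M (\<lambda>f. (\<Sum>i\<in>I. \<phi> (f i)) * (\<Sum>i\<in>I. \<psi> (f i))))"
    by (simp add: algebra_simps lin)
  also have "\<dots> = E (\<lambda>y. \<phi> y * \<psi> y) + E \<phi> * (real (card I) * E \<psi>) + E \<psi> * (real (card I) * E \<phi>) +
      measure_pmf.expectation ?M (\<lambda>f. (\<Sum>i\<in>I. \<phi> (f i)) * (\<Sum>i\<in>I. \<psi> (f i)))"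
    unfolding E_def by simp
  finally show ?case
    using insert by (simp add: algebra_simps power2_eq_square)
qed

text \<open>Samples of both distributions become one sequence of independent pairs, so that
  differences of counts are sums of i.i.d. terms.\<close>

lemma pair_pmf_Pi_pmf:
  fixes p :: "'i \<Rightarrow> 'a pmf" and q :: "'i \<Rightarrow> 'b pmf"
  assumes "finite I"
  shows "pair_pmf (Pi_pmf I d p) (Pi_pmf I e q) =
    map_pmf (\<lambda>h. (fst \<circ> h, snd \<circ> h)) (Pi_pmf I (d, e) (\<lambda>i. pair_pmf (p i) (q i)))"
proof (rule pmf_eqI)
  fix fg :: "('i \<Rightarrow> 'a) \<times> ('i \<Rightarrow> 'b)"
  obtain f g where fg: "fg = (f, g)" by (cases fg)
  let ?z = "\<lambda>h::'i \<Rightarrow> 'a \<times> 'b. (fst \<circ> h, snd \<circ> h)"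
  let ?h = "\<lambda>i. (f i, g i)"
  have inj: "inj ?z"
    by (rule injI) (auto simp: fun_eq_iff intro: prod_eqI)
  have z: "fg = ?z ?h" by (simp add: fg comp_def)
  have "pmf (map_pmf ?z (Pi_pmf I (d, e) (\<lambda>i. pair_pmf (p i) (q i)))) fg =
      pmf (Pi_pmf I (d, e) (\<lambda>i. pair_pmf (p i) (q i))) ?h"
    unfolding z by (rule pmf_map_inj'[OF inj])
  also have "\<dots> = pmf (pair_pmf (Pi_pmf I d p) (Pi_pmf I e q)) fg"
    using assms by (auto simp: fg pmf_pair pmf_Pi prod.distrib)
  finally show "pmf (pair_pmf (Pi_pmf I d p) (Pi_pmf I e q)) fg =
      pmf (map_pmf ?z (Pi_pmf I (d, e) (\<lambda>i. pair_pmf (p i) (q i)))) fg" ..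
qed

text \<open>Absorption, \<open>(k choose j) / (1 + j) = (Suc k choose Suc j) / Suc k\<close>, turns
  the left side into \<open>1 / Suc k\<close> times the expansion of
  \<open>(p + (1 - p)) ^ Suc k\<close> without its term of index 0. This is what makes the weights
  effective: the heavier a point, the smaller the bound on its expected weight.\<close>

lemma expectation_inverse_Suc_binomial:
  assumes "0 \<le> p" "p \<le> 1"
  shows "p * measure_pmf.expectation (binomial_pmf k p) (\<lambda>j. 1 / (1 + real j)) \<le> 1 / real (Suc k)"
proof -
  have "p * measure_pmf.expectation (binomial_pmf k p) (\<lambda>j. 1 / (1 + real j)) =
      p * (\<Sum>j\<le>k. 1 / (1 + real j) * (real (k choose j) * p ^ j * (1 - p) ^ (k - j)))"
    using assms
    by (subst integral_measure_pmf_real[of "{..k}"]) (auto simp: set_pmf_binomial_eq split: if_splits)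
  also have "\<dots> = (\<Sum>j\<le>k. real (Suc k choose Suc j) * p ^ Suc j * (1 - p) ^ (Suc k - Suc j)) / real (Suc k)"
    unfolding sum_distrib_left sum_divide_distrib
  proof (intro sum.cong refl)
    fix j assume "j \<in> {..k}"
    have "real (Suc j) * real (Suc k choose Suc j) = real (Suc k) * real (k choose j)"
      using Suc_times_binomial_eq[of k j] by (metis mult.commute of_nat_mult)
    then have "real (k choose j) / (1 + real j) = real (Suc k choose Suc j) / real (Suc k)"
      by (simp add: field_simps del: binomial_Suc_Suc)
    then show "p * (1 / (1 + real j) * (real (k choose j) * p ^ j * (1 - p) ^ (k - j))) =
        real (Suc k choose Suc j) * p ^ Suc j * (1 - p) ^ (Suc k - Suc j) / real (Suc k)"
      by (simp add: mult_ac divide_inverse del: binomial_Suc_Suc)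
  qed
  also have "(\<Sum>j\<le>k. real (Suc k choose Suc j) * p ^ Suc j * (1 - p) ^ (Suc k - Suc j)) \<le>
      (\<Sum>j\<le>Suc k. real (Suc k choose j) * p ^ j * (1 - p) ^ (Suc k - j))"
    using assms by (subst sum.atMost_Suc_shift) (simp del: binomial_Suc_Suc)
  also have "\<dots> = (p + (1 - p)) ^ Suc k"
    by (rule binomial_ring[symmetric])
  finally show ?thesis by (simp add: divide_right_mono)
qed

section \<open>Occurrence counts and elementary probability bounds\<close>

definition occurrences :: "'i set \<Rightarrow> ('i \<Rightarrow> 'a) \<Rightarrow> 'a \<Rightarrow> nat" where
  "occurrences I f a = card {i \<in> I. f i = a}"

lemma occurrences_map_pmf:
  assumes "finite I"
  shows "map_pmf (\<lambda>f. occurrences I f a) (Pi_pmf I d (\<lambda>_. p)) = binomial_pmf (card I) (pmf p a)"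
proof -
  have bern: "map_pmf (\<lambda>x. x = a) p = bernoulli_pmf (pmf p a)"
  proof (rule pmf_eqI)
    fix b
    have "pmf (map_pmf (\<lambda>x. x = a) p) True = pmf p a"
      by (simp add: pmf_map vimage_def measure_pmf_single)
    then show "pmf (map_pmf (\<lambda>x. x = a) p) b = pmf (bernoulli_pmf (pmf p a)) b"
      by (cases b) (simp_all add: pmf_le_1 pmf_False_conv_True)
  qed
  have "binomial_pmf (card I) (pmf p a) =
      map_pmf (\<lambda>f. card {i \<in> I. f i}) (Pi_pmf I (d = a) (\<lambda>_. map_pmf (\<lambda>x. x = a) p))"
    unfolding bern by (rule binomial_pmf_altdef') (use assms in \<open>auto simp: pmf_le_1\<close>)
  also have "\<dots> = map_pmf (\<lambda>f. occurrences I f a) (Pi_pmf I d (\<lambda>_. p))"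
    using assms by (subst Pi_pmf_map[where dflt = d]) (auto simp: pmf.map_comp comp_def occurrences_def)
  finally show ?thesis ..
qed

lemma expectation_inverse_Suc_occurrences:
  assumes "finite I"
  shows "pmf p a * measure_pmf.expectation (Pi_pmf I d (\<lambda>_. p)) (\<lambda>f. 1 / (1 + real (occurrences I f a)))
    \<le> 1 / real (Suc (card I))"
proof -
  have "measure_pmf.expectation (Pi_pmf I d (\<lambda>_. p)) (\<lambda>f. 1 / (1 + real (occurrences I f a))) =
      measure_pmf.expectation (map_pmf (\<lambda>f. occurrences I f a) (Pi_pmf I d (\<lambda>_. p))) (\<lambda>j. 1 / (1 + real j))"
    by simp
  then show ?thesis
    using expectation_inverse_Suc_binomial[of "pmf p a" "card I"] assms
    by (simp add: occurrences_map_pmf pmf_le_1)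
qed

lemma prob_Markov_pmf:
  fixes f :: "'a \<Rightarrow> real"
  assumes "finite (set_pmf M)" "\<And>x. 0 \<le> f x" "0 < c"
  shows "measure_pmf.prob M {x. c \<le> f x} \<le> measure_pmf.expectation M f / c"
  using integral_Markov_inequality_measure[of M f UNIV c] assms
  by (simp add: integrable_measure_pmf_finite)

text \<open>Averaging over the first stage of a two-stage experiment, only outcomes in
  \<open>G\<close> are credited. The stages are the weights followed by fresh samples, and later the
  random positions followed by the closeness test.\<close>

lemma prob_bind_ge:
  fixes M :: "'a pmf" and K :: "'a \<Rightarrow> 'b pmf"
  assumes "finite (set_pmf M)" and "1 - \<alpha> \<le> measure_pmf.prob M G"
    and "\<And>x. x \<in> set_pmf M \<Longrightarrow> x \<in> G \<Longrightarrow> \<beta> \<le> measure_pmf.prob (K x) S" and "0 \<le> \<beta>"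
  shows "(1 - \<alpha>) * \<beta> \<le> measure_pmf.prob (bind_pmf M K) S"
proof -
  note int = integrable_measure_pmf_finite[OF assms(1)]
  have "(1 - \<alpha>) * \<beta> \<le> measure_pmf.expectation M (\<lambda>x. indicator G x * \<beta>)"
    using assms by (simp add: mult_right_mono)
  also have "\<dots> \<le> measure_pmf.expectation M (\<lambda>x. measure_pmf.prob (K x) S)"
    by (intro integral_mono_AE int) (use assms in \<open>auto simp: AE_measure_pmf_iff indicator_def\<close>)
  also have "\<dots> = measure_pmf.prob (bind_pmf M K) S"
    by (simp add: measure_pmf_bind measure_pmf.measure_bind[where N = "count_space UNIV"]
        measure_pmf_in_subprob_algebra)
  finally show ?thesis .
qed

subsection \<open>The bilinear statistic\<close>

lemma prob_Chebyshev_pmf: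
  fixes f :: "'a \<Rightarrow> real"
  assumes "finite (set_pmf M)" "0 < t"
  shows "measure_pmf.prob M {x. t \<le> \<bar>f x - measure_pmf.expectation M f\<bar>} \<le>
    (measure_pmf.expectation M (\<lambda>x. (f x)\<^sup>2) - (measure_pmf.expectation M f)\<^sup>2) / t\<^sup>2"
proof -
  note int = integrable_measure_pmf_finite[OF assms(1)]
  show ?thesis
    using measure_pmf.Chebyshev_inequality[of f M t] assms(2)
    by (simp add: int measure_pmf.variance_eq[OF int int])
qed

text \<open>Independence of the two blocks makes \<open>S x a * S' y a\<close> an unbiased estimate
  of \<open>(e a)^2\<close>; the square of a count difference from a single block would carry its
  variance as an additional term.\<close>

lemma expectation_bilinear:
  fixes S :: "'w \<Rightarrow> 'a \<Rightarrow> real"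
  assumes "finite (set_pmf M)" "finite (set_pmf N)"
  assumes "\<And>a. measure_pmf.expectation M (\<lambda>\<omega>. S \<omega> a) = e a"
    and "\<And>a. measure_pmf.expectation N (\<lambda>\<omega>. S' \<omega> a) = e a"
  shows "measure_pmf.expectation (pair_pmf M N) (\<lambda>(x, y). \<Sum>a\<in>A. u a * S x a * S' y a) =
    (\<Sum>a\<in>A. u a * (e a)\<^sup>2)"
proof -
  note [simp] = integrable_measure_pmf_finite[OF assms(1)] integrable_measure_pmf_finite[OF assms(2)]
  show ?thesis
    by (simp add: expectation_pair_pmf_finite assms power2_eq_square mult_ac)
qed

text \<open>The square is a double sum of products of a moment of \<open>S\<close> and a moment of
  \<open>S'\<close>. By independence each block contributes one factor \<open>G a b\<close>.\<close>

lemma expectation_bilinear_square: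
  fixes S :: "'w \<Rightarrow> 'a \<Rightarrow> real"
  assumes "finite (set_pmf M)" "finite (set_pmf N)"
  assumes "\<And>a b. measure_pmf.expectation M (\<lambda>\<omega>. S \<omega> a * S \<omega> b) = G a b"
    and "\<And>a b. measure_pmf.expectation N (\<lambda>\<omega>. S' \<omega> a * S' \<omega> b) = G a b"
  shows "measure_pmf.expectation (pair_pmf M N) (\<lambda>(x, y). (\<Sum>a\<in>A. u a * S x a * S' y a)\<^sup>2) =
    (\<Sum>a\<in>A. \<Sum>b\<in>A. u a * u b * (G a b)\<^sup>2)"
proof -
  note [simp] = integrable_measure_pmf_finite[OF assms(1)] integrable_measure_pmf_finite[OF assms(2)]
  have sq: "(\<Sum>a\<in>A. u a * S x a * S' y a)\<^sup>2 =
      (\<Sum>a\<in>A. \<Sum>b\<in>A. u a * u b * (S x a * S x b) * (S' y a * S' y b))" for x y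
    by (simp add: power2_eq_square sum_product mult_ac)
  have "measure_pmf.expectation (pair_pmf M N) (\<lambda>(x, y). (\<Sum>a\<in>A. u a * S x a * S' y a)\<^sup>2) =
      measure_pmf.expectation M (\<lambda>x. measure_pmf.expectation N (\<lambda>y.
        \<Sum>a\<in>A. \<Sum>b\<in>A. u a * u b * (S x a * S x b) * (S' y a * S' y b)))"
    by (simp add: expectation_pair_pmf_finite assms(1,2) sq)
  also have "\<dots> = (\<Sum>a\<in>A. \<Sum>b\<in>A. u a * u b * G a b * G a b)"
    by (simp add: assms(3,4))
  finally show ?thesis
    by (simp add: power2_eq_square mult_ac)
qed

definition count_diff :: "'i set \<Rightarrow> ('i \<Rightarrow> 'a) \<Rightarrow> ('i \<Rightarrow> 'a) \<Rightarrow> 'a \<Rightarrow> real" where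
  "count_diff I f g a = real (occurrences I f a) - real (occurrences I g a)"

lemma count_diff_conv_sum:
  assumes "finite I"
  shows "count_diff I (fst \<circ> h) (snd \<circ> h) a =
    (\<Sum>i\<in>I. of_bool (fst (h i) = a) - of_bool (snd (h i) = a))"
proof -
  have "real (occurrences I f a) = (\<Sum>i\<in>I. of_bool (f i = a))" for f
    using assms unfolding occurrences_def by (simp add: of_bool_def sum.If_cases Int_def)
  then show ?thesis
    by (simp add: count_diff_def sum_subtractf)
qed

lemma expectation_of_bool_eq:
  "measure_pmf.expectation p (\<lambda>x. of_bool (x = a)) = pmf p a"
proof -
  have "measure_pmf.expectation p (\<lambda>x. of_bool (x = a) :: real) =
      measure_pmf.expectation p (indicator {a})"
    by (intro Bochner_Integration.integral_cong) (auto simp: indicator_def)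
  then show ?thesis by (simp add: measure_pmf_single)
qed

context
  fixes p q :: "'a pmf"
  assumes fin: "finite (set_pmf p)" "finite (set_pmf q)"
begin

lemma expectation_count_diff:
  assumes "finite I"
  shows "measure_pmf.expectation (Pi_pmf I d (\<lambda>_. pair_pmf p q))
    (\<lambda>h. count_diff I (fst \<circ> h) (snd \<circ> h) a) = real (card I) * (pmf p a - pmf q a)"
proof -
  have finM: "finite (set_pmf (Pi_pmf I d (\<lambda>_. pair_pmf p q)))"
    using assms fin by (intro finite_set_Pi_pmf) auto
  note [simp] = integrable_measure_pmf_finite[OF fin(1)] integrable_measure_pmf_finite[OF fin(2)]
    integrable_measure_pmf_finite[OF finM]
  have "measure_pmf.expectation (Pi_pmf I d (\<lambda>_. pair_pmf p q))
      (\<lambda>h. count_diff I (fst \<circ> h) (snd \<circ> h) a) =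
    (\<Sum>i\<in>I. measure_pmf.expectation (map_pmf (\<lambda>h. h i) (Pi_pmf I d (\<lambda>_. pair_pmf p q)))
      (\<lambda>z. of_bool (fst z = a) - of_bool (snd z = a)))"
    using assms by (simp add: count_diff_conv_sum)
  also have "\<dots> = (\<Sum>i\<in>I. pmf p a - pmf q a)"
    using assms fin
    by (intro sum.cong refl)
      (simp add: Pi_pmf_component expectation_pair_pmf_finite expectation_of_bool_eq del: integral_map_pmf)
  finally show ?thesis by simp
qed

text \<open>This is the general second moment formula regrouped by powers of \<open>card I\<close>.
  Subtracting the product of the means from the second moment of one pair cancels the mixed terms
  \<open>p a * q b\<close>, so the coefficient of \<open>card I\<close> is the covariance.\<close>

lemma expectation_count_diff_mult:
  assumes "finite I"
  shows "measure_pmf.expectation (Pi_pmf I d (\<lambda>_. pair_pmf p q))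
      (\<lambda>h. count_diff I (fst \<circ> h) (snd \<circ> h) a * count_diff I (fst \<circ> h) (snd \<circ> h) b) =
    real (card I) * ((pmf p a + pmf q a) * of_bool (a = b) - (pmf p a * pmf p b + pmf q a * pmf q b)) +
    real (card I) ^ 2 * ((pmf p a - pmf q a) * (pmf p b - pmf q b))"
proof -
  note [simp] = integrable_measure_pmf_finite[OF fin(1)] integrable_measure_pmf_finite[OF fin(2)]
  define \<phi> :: "'a \<Rightarrow> 'a \<times> 'a \<Rightarrow> real" where "\<phi> = (\<lambda>a z. of_bool (fst z = a) - of_bool (snd z = a))"
  have fin2: "finite (set_pmf (pair_pmf p q))" using fin by simp
  have E1: "measure_pmf.expectation (pair_pmf p q) (\<phi> a) = pmf p a - pmf q a" for a
    using fin by (simp add: \<phi>_def expectation_pair_pmf_finite expectation_of_bool_eq)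
  have mult: "of_bool (x = a) * of_bool (x = b) = of_bool (a = b) * (of_bool (x = a) :: real)" for x
    by auto
  have "measure_pmf.expectation (pair_pmf p q) (\<lambda>z. \<phi> a z * \<phi> b z) =
    measure_pmf.expectation p (\<lambda>x. measure_pmf.expectation q (\<lambda>y.
      of_bool (a = b) * of_bool (x = a) - of_bool (x = a) * of_bool (y = b)
      - of_bool (x = b) * of_bool (y = a) + of_bool (a = b) * of_bool (y = a)))"
    unfolding expectation_pair_pmf_finite[OF fin]
    by (intro Bochner_Integration.integral_cong refl) (auto simp: \<phi>_def)
  also have "\<dots> = of_bool (a = b) * pmf p a - pmf p a * pmf q b - pmf p b * pmf q a + of_bool (a = b) * pmf q a"
    by (simp add: expectation_of_bool_eq)
  finally have E2: "measure_pmf.expectation (pair_pmf p q) (\<lambda>z. \<phi> a z * \<phi> b z) =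
    of_bool (a = b) * pmf p a - pmf p a * pmf q b - pmf p b * pmf q a + of_bool (a = b) * pmf q a" .
  have "count_diff I (fst \<circ> h) (snd \<circ> h) a = (\<Sum>i\<in>I. \<phi> a (h i))" for h :: "'b \<Rightarrow> 'a \<times> 'a" and a
    using assms by (simp add: \<phi>_def count_diff_conv_sum)
  then show ?thesis
    using expectation_sum_mult_sum_Pi_pmf[OF assms fin2, of d "\<phi> a" "\<phi> b"]
    by (simp add: E1 E2 algebra_simps)
qed

text \<open>The covariance matrix of a single pair is \<open>diag (p + q) - p p\<^sup>T - q q\<^sup>T\<close>; the two
  contributions to the variance of the bilinear statistic are bounded separately.\<close>

lemma
  fixes u :: "'a \<Rightarrow> real"
  assumes "finite A" "set_pmf p \<subseteq> A" "set_pmf q \<subseteq> A" and u: "\<And>a. 0 \<le> u a" "\<And>a. u a \<le> 1"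
  defines "\<Gamma> \<equiv> \<lambda>a b. (pmf p a + pmf q a) * of_bool (a = b) - (pmf p a * pmf p b + pmf q a * pmf q b)"
    and "\<delta> \<equiv> \<lambda>a. pmf p a - pmf q a"
    and "B \<equiv> \<Sum>a\<in>A. u a * ((pmf p a)\<^sup>2 + (pmf q a)\<^sup>2)"
  shows covariance_square_bound: "(\<Sum>a\<in>A. \<Sum>b\<in>A. u a * u b * (\<Gamma> a b)\<^sup>2) \<le> 4 * B" (is ?sq)
    and covariance_form_bound: "(\<Sum>a\<in>A. \<Sum>b\<in>A. u a * u b * (\<Gamma> a b * (\<delta> a * \<delta> b)))
      \<le> sqrt (2 * B) * (\<Sum>a\<in>A. u a * (\<delta> a)\<^sup>2)" (is ?form)
proof -
  let ?s = "\<lambda>p. \<Sum>a\<in>A. u a * (pmf p a)\<^sup>2"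
  have B: "B = ?s p + ?s q"
    by (simp add: B_def distrib_left sum.distrib)
  have s: "0 \<le> ?s r" "?s r \<le> 1" if "set_pmf r \<subseteq> A" for r
  proof -
    show "0 \<le> ?s r" using u by (intro sum_nonneg) auto
    have "?s r \<le> (\<Sum>a\<in>A. 1 * (pmf r a * 1))"
      unfolding power2_eq_square using u by (intro sum_mono mult_mono) (auto simp: pmf_le_1)
    then show "?s r \<le> 1" using sum_pmf_eq_1[OF assms(1) that] by simp
  qed
  have u2: "(u a)\<^sup>2 \<le> u a" for a
    using u[of a] by (simp add: power2_eq_square mult_left_le)
  have pq: "(x + y)\<^sup>2 \<le> 2 * (x\<^sup>2 + y\<^sup>2)" for x y :: real
    using sum_squares_bound[of x y] by (simp add: power2_sum)
  have diag: "(\<Sum>a\<in>A. (u a)\<^sup>2 * (pmf p a + pmf q a)\<^sup>2) \<le> 2 * B"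
  proof -
    have "(\<Sum>a\<in>A. (u a)\<^sup>2 * (pmf p a + pmf q a)\<^sup>2) \<le>
        (\<Sum>a\<in>A. u a * (2 * ((pmf p a)\<^sup>2 + (pmf q a)\<^sup>2)))"
      using u u2 pq by (intro sum_mono mult_mono) auto
    then show ?thesis by (simp add: B_def sum_distrib_left mult_ac)
  qed
  have cross: "(\<Sum>a\<in>A. \<Sum>b\<in>A. u a * u b * (pmf r a * pmf r b)\<^sup>2) = (?s r)\<^sup>2" for r
    by (simp add: power2_eq_square sum_product mult_ac)
  have "(\<Gamma> a b)\<^sup>2 \<le> of_bool (a = b) * (pmf p a + pmf q a)\<^sup>2 +
      2 * ((pmf p a * pmf p b)\<^sup>2 + (pmf q a * pmf q b)\<^sup>2)" for a b
  proof -
    \<comment> \<open>Both parts of \<Gamma> are nonnegative, so the cross term of the square has a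
      favourable sign.\<close>
    have "(x - y)\<^sup>2 \<le> x\<^sup>2 + y\<^sup>2" if "0 \<le> x" "0 \<le> y" for x y :: real
      using that by (simp add: power2_diff)
    then have "(\<Gamma> a b)\<^sup>2 \<le> ((pmf p a + pmf q a) * of_bool (a = b))\<^sup>2 +
        (pmf p a * pmf p b + pmf q a * pmf q b)\<^sup>2"
      unfolding \<Gamma>_def by simp
    then show ?thesis
      using pq[of "pmf p a * pmf p b" "pmf q a * pmf q b"]
      by (auto split: if_splits simp: of_bool_def)
  qed
  then have "(\<Sum>a\<in>A. \<Sum>b\<in>A. u a * u b * (\<Gamma> a b)\<^sup>2) \<le>
      (\<Sum>a\<in>A. \<Sum>b\<in>A. u a * u b * (of_bool (a = b) * (pmf p a + pmf q a)\<^sup>2 +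
        2 * ((pmf p a * pmf p b)\<^sup>2 + (pmf q a * pmf q b)\<^sup>2)))"
    using u by (intro sum_mono mult_left_mono) auto
  also have "\<dots> = (\<Sum>a\<in>A. (u a)\<^sup>2 * (pmf p a + pmf q a)\<^sup>2) + 2 * ((?s p)\<^sup>2 + (?s q)\<^sup>2)"
  proof -
    have "(\<Sum>b\<in>A. u a * u b * (of_bool (a = b) * (pmf p a + pmf q a)\<^sup>2)) =
        (u a)\<^sup>2 * (pmf p a + pmf q a)\<^sup>2" if "a \<in> A" for a
    proof -
      have "(\<Sum>b\<in>A. u a * u b * (of_bool (a = b) * (pmf p a + pmf q a)\<^sup>2)) =
        (\<Sum>b\<in>A. if a = b then u a * u a * (pmf p a + pmf q a)\<^sup>2 else 0)"
        by (intro sum.cong) auto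
      then show ?thesis using that assms(1) by (simp add: power2_eq_square)
    qed
    then show ?thesis
      by (simp add: distrib_left sum.distrib cross[symmetric] sum_distrib_left mult_ac cong: sum.cong)
  qed
  \<comment> \<open>Both values of \<open>?s\<close> lie between 0 and 1 and hence bound their own
    squares.\<close>
  also have "\<dots> \<le> 2 * B + 2 * (?s p + ?s q)"
    using diag s[OF assms(2)] s[OF assms(3)] by (intro add_mono mult_left_mono) (auto simp: power2_eq_square mult_left_le)
  finally show ?sq by (simp add: B)
  let ?t = "\<lambda>p. \<Sum>a\<in>A. u a * pmf p a * (\<delta> a)\<^sup>2"
  \<comment> \<open>The rank-one parts of \<Gamma> become two subtracted squares, which the next
    step drops; only the diagonal part survives.\<close>
  have "(\<Sum>a\<in>A. \<Sum>b\<in>A. u a * u b * (\<Gamma> a b * (\<delta> a * \<delta> b))) =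
      (\<Sum>a\<in>A. \<Sum>b\<in>A. if a = b then (u a)\<^sup>2 * (pmf p a + pmf q a) * (\<delta> a)\<^sup>2 else 0) -
      (\<Sum>a\<in>A. u a * pmf p a * \<delta> a)\<^sup>2 - (\<Sum>a\<in>A. u a * pmf q a * \<delta> a)\<^sup>2"
    unfolding power2_eq_square sum_product sum_subtractf[symmetric]
    by (intro sum.cong refl) (auto simp: \<Gamma>_def algebra_simps)
  also have "\<dots> \<le> (\<Sum>a\<in>A. (u a)\<^sup>2 * (pmf p a + pmf q a) * (\<delta> a)\<^sup>2)"
    using assms(1) by (simp add: algebra_simps)
  also have "\<dots> \<le> (\<Sum>a\<in>A. sqrt (2 * B) * (u a * (\<delta> a)\<^sup>2))"
  proof (rule sum_mono)
    fix a assume a: "a \<in> A"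
    \<comment> \<open>A single entry of the vector \<open>u a * (p a + q a)\<close> is at most its
      Euclidean norm, which \<open>diag\<close> bounds by \<open>sqrt (2 * B)\<close>.\<close>
    have "(u a * (pmf p a + pmf q a))\<^sup>2 \<le> (\<Sum>a\<in>A. (u a)\<^sup>2 * (pmf p a + pmf q a)\<^sup>2)"
      using a assms(1) by (auto simp: power_mult_distrib intro!: member_le_sum)
    then have "u a * (pmf p a + pmf q a) \<le> sqrt (2 * B)"
      using diag by (intro real_le_rsqrt) auto
    then have "u a * (pmf p a + pmf q a) * (u a * (\<delta> a)\<^sup>2) \<le> sqrt (2 * B) * (u a * (\<delta> a)\<^sup>2)"
      using u by (intro mult_right_mono) auto
    then show "(u a)\<^sup>2 * (pmf p a + pmf q a) * (\<delta> a)\<^sup>2 \<le> sqrt (2 * B) * (u a * (\<delta> a)\<^sup>2)"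
      by (simp add: power2_eq_square mult_ac)
  qed
  finally show ?form by (simp add: sum_distrib_left)
qed

text \<open>Chebyshev's inequality. In the second moment, the square of the mean part
  \<open>r^2 * (\<delta> a * \<delta> b)\<close> contributes exactly the squared mean, so the
  variance consists of a pure covariance part and a mixed part. These are controlled by the two
  preceding bounds.\<close>

lemma bilinear_statistic_concentration:
  fixes u :: "'a \<Rightarrow> real"
  assumes "finite A" "set_pmf p \<subseteq> A" "set_pmf q \<subseteq> A" and u: "\<And>a. 0 \<le> u a" "\<And>a. u a \<le> 1"
    and I: "finite I" "card I = r" and J: "finite J" "card J = r" and "0 < t"
  defines "D \<equiv> \<Sum>a\<in>A. u a * (pmf p a - pmf q a)\<^sup>2"
    and "B \<equiv> \<Sum>a\<in>A. u a * ((pmf p a)\<^sup>2 + (pmf q a)\<^sup>2)"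
    and "W \<equiv> \<lambda>(f, g). \<Sum>a\<in>A. u a * count_diff I (fst \<circ> f) (snd \<circ> f) a * count_diff J (fst \<circ> g) (snd \<circ> g) a"
  shows "measure_pmf.prob (pair_pmf (Pi_pmf I d (\<lambda>_. pair_pmf p q)) (Pi_pmf J e (\<lambda>_. pair_pmf p q)))
      {h. t \<le> \<bar>W h - real r ^ 2 * D\<bar>} \<le> (4 * real r ^ 2 * B + 2 * real r ^ 3 * (sqrt (2 * B) * D)) / t\<^sup>2"
proof -
  let ?M = "Pi_pmf I d (\<lambda>_. pair_pmf p q)" and ?N = "Pi_pmf J e (\<lambda>_. pair_pmf p q)"
  define \<Gamma> where "\<Gamma> = (\<lambda>a b. (pmf p a + pmf q a) * of_bool (a = b) - (pmf p a * pmf p b + pmf q a * pmf q b))"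
  define \<delta> where "\<delta> = (\<lambda>a. pmf p a - pmf q a)"
  let ?R = "real r"
  have finM: "finite (set_pmf ?M)" and finN: "finite (set_pmf ?N)"
    using I J fin by (auto intro!: finite_set_Pi_pmf)
  have EW: "measure_pmf.expectation (pair_pmf ?M ?N) W = ?R\<^sup>2 * D"
    unfolding W_def
    by (subst expectation_bilinear[OF finM finN expectation_count_diff[OF I(1), unfolded I]
        expectation_count_diff[OF J(1), unfolded J]])
      (simp add: D_def power_mult_distrib sum_distrib_left mult_ac)
  have "measure_pmf.expectation (pair_pmf ?M ?N) (\<lambda>h. (W h)\<^sup>2) =
      measure_pmf.expectation (pair_pmf ?M ?N) (\<lambda>(f, g). (\<Sum>a\<in>A.
        u a * count_diff I (fst \<circ> f) (snd \<circ> f) a * count_diff J (fst \<circ> g) (snd \<circ> g) a)\<^sup>2)"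
    by (simp add: W_def split_def)
  also have "\<dots> = (\<Sum>a\<in>A. \<Sum>b\<in>A. u a * u b * (?R * \<Gamma> a b + ?R\<^sup>2 * (\<delta> a * \<delta> b))\<^sup>2)"
    by (subst expectation_bilinear_square[OF finM finN expectation_count_diff_mult[OF I(1), unfolded I]
        expectation_count_diff_mult[OF J(1), unfolded J]]) (simp add: \<Gamma>_def \<delta>_def)
  also have "\<dots> = ?R\<^sup>2 * (\<Sum>a\<in>A. \<Sum>b\<in>A. u a * u b * (\<Gamma> a b)\<^sup>2) +
      2 * ?R ^ 3 * (\<Sum>a\<in>A. \<Sum>b\<in>A. u a * u b * (\<Gamma> a b * (\<delta> a * \<delta> b))) + (?R\<^sup>2 * D)\<^sup>2"
  proof -
    have "(?R\<^sup>2 * D)\<^sup>2 = ?R ^ 4 * (\<Sum>a\<in>A. \<Sum>b\<in>A. u a * (\<delta> a)\<^sup>2 * (u b * (\<delta> b)\<^sup>2))"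
      by (simp add: D_def \<delta>_def power2_eq_square sum_product mult_ac power4_eq_xxxx)
    then show ?thesis
      unfolding sum_distrib_left
      by (simp add: sum_distrib_left sum.distrib[symmetric])
        (intro sum.cong refl, simp add: power2_eq_square power3_eq_cube power4_eq_xxxx algebra_simps)
  qed
  also have "\<dots> \<le> ?R\<^sup>2 * (4 * B) + 2 * ?R ^ 3 * (sqrt (2 * B) * D) + (?R\<^sup>2 * D)\<^sup>2"
    unfolding \<Gamma>_def \<delta>_def B_def D_def
    by (intro add_mono mult_left_mono covariance_square_bound covariance_form_bound order_refl assms) auto
  finally have var: "measure_pmf.expectation (pair_pmf ?M ?N) (\<lambda>h. (W h)\<^sup>2) - (?R\<^sup>2 * D)\<^sup>2 \<le>
      4 * ?R\<^sup>2 * B + 2 * ?R ^ 3 * (sqrt (2 * B) * D)" by simp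
  have "finite (set_pmf (pair_pmf ?M ?N))" using finM finN by simp
  from prob_Chebyshev_pmf[OF this \<open>0 < t\<close>, of W] show ?thesis
    unfolding EW by (rule order_trans) (intro divide_right_mono var, simp)
qed

end

subsection \<open>Testing closeness with few samples\<close>

text \<open>Occurrences in both samples enter the denominator, so a single weight damps the points
  that are heavy under either distribution.\<close>

definition weight :: "'i set \<Rightarrow> ('i \<Rightarrow> 'a) \<Rightarrow> ('i \<Rightarrow> 'a) \<Rightarrow> 'a \<Rightarrow> real" where
  "weight I f g a = 1 / (1 + real (occurrences I f a) + real (occurrences I g a))"

lemma weight_pos: "0 < weight I f g a" and weight_le_1: "weight I f g a \<le> 1"
  by (simp_all add: weight_def field_simps add_pos_nonneg)

lemma occurrences_cong:
  assumes "\<And>i. i \<in> I \<Longrightarrow> f i = g i"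
  shows "occurrences I f a = occurrences I g a"
  unfolding occurrences_def using assms by (intro arg_cong[where f = card]) auto

lemma count_diff_cong:
  assumes "\<And>i. i \<in> I \<Longrightarrow> f i = f' i" "\<And>i. i \<in> I \<Longrightarrow> g i = g' i"
  shows "count_diff I f g a = count_diff I f' g' a"
  using occurrences_cong[of I f f' a] occurrences_cong[of I g g' a] assms by (simp add: count_diff_def)

lemma weight_cong:
  assumes "\<And>i. i \<in> I \<Longrightarrow> f i = f' i" "\<And>i. i \<in> I \<Longrightarrow> g i = g' i"
  shows "weight I f g a = weight I f' g' a"
  using occurrences_cong[of I f f' a] occurrences_cong[of I g g' a] assms by (simp add: weight_def)

lemma sum_occurrences_le:
  assumes "finite I" "finite S"
  shows "(\<Sum>a\<in>S. occurrences I f a) \<le> card I"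
proof -
  have "(\<Sum>a\<in>S. occurrences I f a) = card (\<Union>a\<in>S. {i \<in> I. f i = a})"
    unfolding occurrences_def using assms by (subst card_UN_disjoint) auto
  also have "\<dots> \<le> card I"
    using assms by (intro card_mono) auto
  finally show ?thesis .
qed

text \<open>Cauchy-Schwarz against the inverse weights: their sum over \<open>S\<close> is
  \<open>card S\<close> plus the occurrences of points of \<open>S\<close>, at most
  \<open>card I\<close> for each sample. The bound holds for every outcome of the weights, and the
  choice of a small \<open>S\<close> keeps the size of \<open>A\<close> out of it.\<close>

lemma weighted_l2_ge:
  assumes "finite A" "S \<subseteq> A" "finite I"
  shows "(\<Sum>a\<in>S. \<bar>x a\<bar>)\<^sup>2 \<le>
    (real (card S) + 2 * real (card I)) * (\<Sum>a\<in>A. weight I f g a * (x a)\<^sup>2)"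
proof -
  have finS: "finite S" using assms finite_subset by blast
  let ?u = "weight I f g"
  have "(\<Sum>a\<in>S. \<bar>x a\<bar>)\<^sup>2 = (\<Sum>a\<in>S. sqrt (1 / ?u a) * (sqrt (?u a) * \<bar>x a\<bar>))\<^sup>2"
    by (intro arg_cong[where f = "\<lambda>x. x\<^sup>2"] sum.cong)
      (simp_all add: real_sqrt_mult[symmetric] mult.assoc[symmetric]
        weight_pos[THEN less_imp_neq, symmetric])
  also have "\<dots> \<le> (\<Sum>a\<in>S. (sqrt (1 / ?u a))\<^sup>2) * (\<Sum>a\<in>S. (sqrt (?u a) * \<bar>x a\<bar>)\<^sup>2)"
    by (rule Cauchy_Schwarz_ineq_sum)
  also have "(\<Sum>a\<in>S. (sqrt (1 / ?u a))\<^sup>2) =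
      real (card S + (\<Sum>a\<in>S. occurrences I f a) + (\<Sum>a\<in>S. occurrences I g a))"
    by (simp add: weight_pos less_imp_le) (simp add: weight_def sum.distrib)
  also have "(\<Sum>a\<in>S. (sqrt (?u a) * \<bar>x a\<bar>)\<^sup>2) = (\<Sum>a\<in>S. ?u a * (x a)\<^sup>2)"
    by (simp add: power_mult_distrib weight_pos less_imp_le)
  also have "real (card S + (\<Sum>a\<in>S. occurrences I f a) + (\<Sum>a\<in>S. occurrences I g a)) *
      (\<Sum>a\<in>S. ?u a * (x a)\<^sup>2) \<le> (real (card S) + 2 * real (card I)) * (\<Sum>a\<in>A. ?u a * (x a)\<^sup>2)"
    using of_nat_mono[OF sum_occurrences_le[OF assms(3) finS, of f], where 'a = real]
      of_nat_mono[OF sum_occurrences_le[OF assms(3) finS, of g], where 'a = real]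
    by (intro mult_mono sum_mono2 assms sum_nonneg) (auto simp: weight_pos less_imp_le)
  finally show ?thesis .
qed

text \<open>One factor \<open>pmf p a\<close> of the square is absorbed by the expected weight,
  leaving \<open>1 / Suc (card I)\<close>; the other factor sums to 1 over \<open>A\<close>. The
  same holds for \<open>q\<close>, hence the numerator 2.\<close>

lemma expectation_weighted_l2:
  fixes p q :: "'a pmf"
  assumes fin: "finite A" "set_pmf p \<subseteq> A" "set_pmf q \<subseteq> A" "finite I"
  shows "measure_pmf.expectation (Pi_pmf I (d, e) (\<lambda>_. pair_pmf p q))
      (\<lambda>h. \<Sum>a\<in>A. weight I (fst \<circ> h) (snd \<circ> h) a * ((pmf p a)\<^sup>2 + (pmf q a)\<^sup>2)) \<le> 2 / real (Suc (card I))"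
proof -
  let ?P = "Pi_pmf I d (\<lambda>_. p)" and ?Q = "Pi_pmf I e (\<lambda>_. q)"
  have finP: "finite (set_pmf ?P)" and finQ: "finite (set_pmf ?Q)"
    using fin finite_subset by (auto intro!: finite_set_Pi_pmf)
  then have "finite (set_pmf (pair_pmf ?P ?Q))" by simp
  note int[simp] = integrable_measure_pmf_finite[OF this]
  let ?E = "measure_pmf.expectation (pair_pmf ?P ?Q)"
  have wP: "pmf p a * ?E (\<lambda>z. weight I (fst z) (snd z) a) \<le> 1 / real (Suc (card I))" for a
  proof -
    have "pmf p a * ?E (\<lambda>z. weight I (fst z) (snd z) a) \<le>
        pmf p a * ?E (\<lambda>z. 1 / (1 + real (occurrences I (fst z) a)))"
      by (intro mult_left_mono integral_mono int) (auto simp: weight_def intro!: divide_left_mono)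
    also have "\<dots> = pmf p a * measure_pmf.expectation ?P (\<lambda>f. 1 / (1 + real (occurrences I f a)))"
      by (simp only: expectation_pair_pmf_fst[where f = "\<lambda>f. 1 / (1 + real (occurrences I f a))"])
    finally show ?thesis
      using expectation_inverse_Suc_occurrences[OF fin(4), of p a d] by simp
  qed
  have wQ: "pmf q a * ?E (\<lambda>z. weight I (fst z) (snd z) a) \<le> 1 / real (Suc (card I))" for a
  proof -
    have "pmf q a * ?E (\<lambda>z. weight I (fst z) (snd z) a) \<le>
        pmf q a * ?E (\<lambda>z. 1 / (1 + real (occurrences I (snd z) a)))"
      by (intro mult_left_mono integral_mono int) (auto simp: weight_def intro!: divide_left_mono)
    also have "\<dots> = pmf q a * measure_pmf.expectation ?Q (\<lambda>f. 1 / (1 + real (occurrences I f a)))"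
      by (simp only: expectation_pair_pmf_snd[where f = "\<lambda>f. 1 / (1 + real (occurrences I f a))"])
    finally show ?thesis
      using expectation_inverse_Suc_occurrences[OF fin(4), of q a e] by simp
  qed
  have "measure_pmf.expectation (Pi_pmf I (d, e) (\<lambda>_. pair_pmf p q))
      (\<lambda>h. \<Sum>a\<in>A. weight I (fst \<circ> h) (snd \<circ> h) a * ((pmf p a)\<^sup>2 + (pmf q a)\<^sup>2)) =
      ?E (\<lambda>z. \<Sum>a\<in>A. weight I (fst z) (snd z) a * ((pmf p a)\<^sup>2 + (pmf q a)\<^sup>2))"
    unfolding pair_pmf_Pi_pmf[OF fin(4)] by simp
  also have "\<dots> = (\<Sum>a\<in>A. pmf p a * (pmf p a * ?E (\<lambda>z. weight I (fst z) (snd z) a)) +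
      pmf q a * (pmf q a * ?E (\<lambda>z. weight I (fst z) (snd z) a)))"
    by (simp add: power2_eq_square algebra_simps)
  also have "\<dots> \<le> (\<Sum>a\<in>A. pmf p a * (1 / real (Suc (card I))) + pmf q a * (1 / real (Suc (card I))))"
    by (intro sum_mono add_mono mult_left_mono wP wQ) auto
  also have "\<dots> = 2 / real (Suc (card I))"
    using sum_pmf_eq_1[OF fin(1,2)] sum_pmf_eq_1[OF fin(1,3)]
    by (simp add: sum.distrib sum_divide_distrib[symmetric])
  finally show ?thesis .
qed

definition closeness_statistic ::
  "'a set \<Rightarrow> 'i set \<Rightarrow> 'i set \<Rightarrow> 'i set \<Rightarrow> ('i \<Rightarrow> 'a) \<Rightarrow> ('i \<Rightarrow> 'a) \<Rightarrow> real" where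
  "closeness_statistic A I\<^sub>0 I\<^sub>1 I\<^sub>2 f g =
     (\<Sum>a\<in>A. weight I\<^sub>0 f g a * count_diff I\<^sub>1 f g a * count_diff I\<^sub>2 f g a)"

text \<open>The weight and the two count differences look at disjoint blocks and are therefore
  independent. Drawing block \<open>I\<^sub>0\<close> first allows the analysis to fix the weights
  and to average over them afterwards.\<close>

lemma closeness_statistic_blocks:
  fixes p q :: "'a pmf" and d e :: 'a and I\<^sub>0 I\<^sub>1 I\<^sub>2 :: "'i set"
  assumes fin: "finite I\<^sub>0" "finite I\<^sub>1" "finite I\<^sub>2"
    and dis: "I\<^sub>0 \<inter> I\<^sub>1 = {}" "I\<^sub>0 \<inter> I\<^sub>2 = {}" "I\<^sub>1 \<inter> I\<^sub>2 = {}"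
  defines "P \<equiv> \<lambda>I. Pi_pmf I (d, e) (\<lambda>_. pair_pmf p q)"
  shows "map_pmf (\<lambda>(f, g). closeness_statistic A I\<^sub>0 I\<^sub>1 I\<^sub>2 f g)
      (pair_pmf (Pi_pmf (I\<^sub>0 \<union> (I\<^sub>1 \<union> I\<^sub>2)) d (\<lambda>_. p)) (Pi_pmf (I\<^sub>0 \<union> (I\<^sub>1 \<union> I\<^sub>2)) e (\<lambda>_. q))) =
    bind_pmf (P I\<^sub>0) (\<lambda>h\<^sub>0. map_pmf (\<lambda>(h\<^sub>1, h\<^sub>2). \<Sum>a\<in>A. weight I\<^sub>0 (fst \<circ> h\<^sub>0) (snd \<circ> h\<^sub>0) a *
        count_diff I\<^sub>1 (fst \<circ> h\<^sub>1) (snd \<circ> h\<^sub>1) a * count_diff I\<^sub>2 (fst \<circ> h\<^sub>2) (snd \<circ> h\<^sub>2) a)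
      (pair_pmf (P I\<^sub>1) (P I\<^sub>2)))"
proof -
  let ?m = "\<lambda>I f g x. if x \<in> I then f x else g x"
  have stat: "closeness_statistic A I\<^sub>0 I\<^sub>1 I\<^sub>2 (fst \<circ> ?m I\<^sub>0 h\<^sub>0 (?m I\<^sub>1 h\<^sub>1 h\<^sub>2)) (snd \<circ> ?m I\<^sub>0 h\<^sub>0 (?m I\<^sub>1 h\<^sub>1 h\<^sub>2)) =
    (\<Sum>a\<in>A. weight I\<^sub>0 (fst \<circ> h\<^sub>0) (snd \<circ> h\<^sub>0) a *
        count_diff I\<^sub>1 (fst \<circ> h\<^sub>1) (snd \<circ> h\<^sub>1) a * count_diff I\<^sub>2 (fst \<circ> h\<^sub>2) (snd \<circ> h\<^sub>2) a)"
    for h\<^sub>0 h\<^sub>1 h\<^sub>2 :: "'i \<Rightarrow> 'a \<times> 'a"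
    unfolding closeness_statistic_def using dis
    by (intro sum.cong refl arg_cong2[where f = "(*)"] weight_cong count_diff_cong) auto
  have "finite (I\<^sub>0 \<union> (I\<^sub>1 \<union> I\<^sub>2))" using fin by simp
  from pair_pmf_Pi_pmf[OF this, of d "\<lambda>_. p" e "\<lambda>_. q"]
  have "map_pmf (\<lambda>(f, g). closeness_statistic A I\<^sub>0 I\<^sub>1 I\<^sub>2 f g)
      (pair_pmf (Pi_pmf (I\<^sub>0 \<union> (I\<^sub>1 \<union> I\<^sub>2)) d (\<lambda>_. p)) (Pi_pmf (I\<^sub>0 \<union> (I\<^sub>1 \<union> I\<^sub>2)) e (\<lambda>_. q))) =
    map_pmf (\<lambda>h. closeness_statistic A I\<^sub>0 I\<^sub>1 I\<^sub>2 (fst \<circ> h) (snd \<circ> h)) (P (I\<^sub>0 \<union> (I\<^sub>1 \<union> I\<^sub>2)))"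
    by (simp add: pmf.map_comp comp_def P_def)
  also have "P (I\<^sub>0 \<union> (I\<^sub>1 \<union> I\<^sub>2)) = map_pmf (\<lambda>(h\<^sub>0, h\<^sub>1, h\<^sub>2). ?m I\<^sub>0 h\<^sub>0 (?m I\<^sub>1 h\<^sub>1 h\<^sub>2))
      (pair_pmf (P I\<^sub>0) (pair_pmf (P I\<^sub>1) (P I\<^sub>2)))"
    unfolding P_def using fin dis
    by (subst Pi_pmf_union, simp, simp, blast, subst Pi_pmf_union)
      (auto simp: pair_map_pmf2 pmf.map_comp intro!: pmf.map_cong)
  finally show ?thesis
    by (simp add: pmf.map_comp comp_def stat[unfolded comp_def] split_def pair_pmf_def[of "P I\<^sub>0"] map_bind_pmf
        bind_return_pmf bind_assoc_pmf) (simp add: map_pmf_def bind_return_pmf bind_assoc_pmf)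
qed

text \<open>\<open>D'\<close> sets the scale of the allowed deviation. It will be
  \<open>D\<^sub>0\<close> when the distributions coincide and the weighted distance itself when
  they are far apart.\<close>

lemma closeness_deviation:
  fixes p q :: "'a pmf"
  assumes fin: "finite A" "set_pmf p \<subseteq> A" "set_pmf q \<subseteq> A" and u: "\<And>a. 0 \<le> u a" "\<And>a. u a \<le> 1"
    and I: "finite I" "card I = r" and J: "finite J" "card J = r"
    and B: "15625 * (\<Sum>a\<in>A. u a * ((pmf p a)\<^sup>2 + (pmf q a)\<^sup>2)) \<le> (real r * D\<^sub>0)\<^sup>2"
    and D: "0 < D\<^sub>0" "D\<^sub>0 \<le> D'" "(\<Sum>a\<in>A. u a * (pmf p a - pmf q a)\<^sup>2) \<le> D'" and "0 < r"
  shows "9 / 10 \<le> measure_pmf.prob (pair_pmf (Pi_pmf I d (\<lambda>_. pair_pmf p q)) (Pi_pmf J e (\<lambda>_. pair_pmf p q)))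
      {(f, g). \<bar>(\<Sum>a\<in>A. u a * count_diff I (fst \<circ> f) (snd \<circ> f) a * count_diff J (fst \<circ> g) (snd \<circ> g) a)
         - real r ^ 2 * (\<Sum>a\<in>A. u a * (pmf p a - pmf q a)\<^sup>2)\<bar> < real r ^ 2 * D' / 2}"
proof -
  define B where "B = (\<Sum>a\<in>A. u a * ((pmf p a)\<^sup>2 + (pmf q a)\<^sup>2))"
  define D where "D = (\<Sum>a\<in>A. u a * (pmf p a - pmf q a)\<^sup>2)"
  define W where "W = (\<lambda>(f, g). \<Sum>a\<in>A. u a * count_diff I (fst \<circ> f) (snd \<circ> f) a * count_diff J (fst \<circ> g) (snd \<circ> g) a)"
  let ?M = "pair_pmf (Pi_pmf I d (\<lambda>_. pair_pmf p q)) (Pi_pmf J e (\<lambda>_. pair_pmf p q))"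
  let ?t = "real r ^ 2 * D' / 2"
  have finpq: "finite (set_pmf p)" "finite (set_pmf q)" using fin finite_subset by blast+
  have rD: "0 < real r * D'" using D \<open>0 < r\<close> by auto
  have t: "0 < ?t" using D \<open>0 < r\<close> by auto
  have B0: "0 \<le> B" unfolding B_def using u by (intro sum_nonneg) auto
  \<comment> \<open>\<open>y\<close> compares the noise with the signal: the two terms of the
    Chebyshev bound are \<open>8 * y^2\<close> and \<open>8 * y\<close>. Since
    \<open>15625 = 125^2\<close>, \<open>y\<close> is at most \<open>sqrt 2 / 125\<close>, small
    enough for a total of at most \<open>1 / 10\<close>.\<close>
  define y where "y = sqrt (2 * B) / (real r * D')"
  have "(real r * D\<^sub>0)\<^sup>2 \<le> (real r * D')\<^sup>2"
    using D by (intro power_mono mult_left_mono) auto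
  with B have le: "15625 * B \<le> (real r * D')\<^sup>2" by (simp add: B_def)
  have y2: "y\<^sup>2 = 2 * B / (real r * D')\<^sup>2"
    using B0 by (simp add: y_def power_divide)
  also have "\<dots> \<le> 2 / 15625"
    using le zero_less_power[OF rD, of 2] by (subst pos_divide_le_eq) linarith+
  finally have y2_le: "y\<^sup>2 \<le> 2 / 15625" .
  also have "\<dots> \<le> (12 / 1000)\<^sup>2" by (simp add: power2_eq_square)
  finally have y: "y \<le> 12 / 1000" by (rule power2_le_imp_le) simp
  have "measure_pmf.prob ?M {h. ?t \<le> \<bar>W h - real r ^ 2 * D\<bar>} \<le>
      (4 * real r ^ 2 * B + 2 * real r ^ 3 * (sqrt (2 * B) * D)) / ?t\<^sup>2"
    unfolding W_def B_def D_def
    by (rule bilinear_statistic_concentration) (fact finpq fin u I J t)+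
  also have "\<dots> \<le> (4 * real r ^ 2 * B + 2 * real r ^ 3 * (sqrt (2 * B) * D')) / ?t\<^sup>2"
    using D B0 by (intro divide_right_mono add_left_mono mult_left_mono) (auto simp: D_def)
  also have "\<dots> = 8 * y\<^sup>2 + 8 * y"
    using less_le_trans[OF D(1,2)] \<open>0 < r\<close> unfolding y2 by (simp add: y_def field_simps power2_eq_square power3_eq_cube)
  also have "\<dots> \<le> 1 / 10" using y y2_le by simp
  finally have "measure_pmf.prob ?M {h. ?t \<le> \<bar>W h - real r ^ 2 * D\<bar>} \<le> 1 / 10" .
  moreover have "measure_pmf.prob ?M {h. \<bar>W h - real r ^ 2 * D\<bar> < ?t} =
      1 - measure_pmf.prob ?M {h. ?t \<le> \<bar>W h - real r ^ 2 * D\<bar>}"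
    by (subst measure_pmf.prob_compl[symmetric]) (auto intro!: arg_cong[where f = "measure_pmf.prob ?M"])
  ultimately show ?thesis by (simp add: W_def D_def split_def)
qed

text \<open>The threshold is half the mean of the statistic at weighted distance
  \<open>D\<^sub>0\<close>. Markov's inequality discards \<open>1 / 10\<close> of the weights and
  Chebyshev's inequality \<open>1 / 10\<close> of the fresh samples, so \<open>(9 / 10)^2\<close>
  remains. The constant 312500 is \<open>20 * 15625\<close>, where 20 is ten times the numerator in
  \<open>expectation_weighted_l2\<close> and 15625 comes from
  \<open>closeness_deviation\<close>.\<close>

lemma closeness_test:
  fixes p q :: "'a pmf" and d e :: 'a and I\<^sub>0 I\<^sub>1 I\<^sub>2 :: "'i set"
  assumes finA: "finite A" "set_pmf p \<subseteq> A" "set_pmf q \<subseteq> A"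
    and fin: "finite I\<^sub>0" "finite I\<^sub>1" "finite I\<^sub>2"
    and dis: "I\<^sub>0 \<inter> I\<^sub>1 = {}" "I\<^sub>0 \<inter> I\<^sub>2 = {}" "I\<^sub>1 \<inter> I\<^sub>2 = {}"
    and r: "card I\<^sub>1 = r" "card I\<^sub>2 = r" "0 < r"
    and D\<^sub>0: "0 < D\<^sub>0" "312500 / real (Suc (card I\<^sub>0)) \<le> (real r * D\<^sub>0)\<^sup>2"
  defines "M \<equiv> pair_pmf (Pi_pmf (I\<^sub>0 \<union> (I\<^sub>1 \<union> I\<^sub>2)) d (\<lambda>_. p)) (Pi_pmf (I\<^sub>0 \<union> (I\<^sub>1 \<union> I\<^sub>2)) e (\<lambda>_. q))"
  shows closeness_test_complete: "p = q \<Longrightarrow> 81 / 100 \<le>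
      measure_pmf.prob M {(f, g). closeness_statistic A I\<^sub>0 I\<^sub>1 I\<^sub>2 f g \<le> real r ^ 2 * D\<^sub>0 / 2}"
    and closeness_test_sound:
      "\<And>S. S \<subseteq> A \<Longrightarrow> D\<^sub>0 * (real (card S) + 2 * real (card I\<^sub>0)) \<le> (\<Sum>a\<in>S. \<bar>pmf p a - pmf q a\<bar>)\<^sup>2 \<Longrightarrow>
        0 < card S + card I\<^sub>0 \<Longrightarrow>
        81 / 100 \<le> measure_pmf.prob M {(f, g). \<not> closeness_statistic A I\<^sub>0 I\<^sub>1 I\<^sub>2 f g \<le> real r ^ 2 * D\<^sub>0 / 2}"
proof -
  let ?P = "\<lambda>I. Pi_pmf I (d, e) (\<lambda>_. pair_pmf p q)"
  let ?u = "\<lambda>h. weight I\<^sub>0 (fst \<circ> h) (snd \<circ> h)"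
  let ?B = "\<lambda>h. \<Sum>a\<in>A. ?u h a * ((pmf p a)\<^sup>2 + (pmf q a)\<^sup>2)"
  let ?D = "\<lambda>h. \<Sum>a\<in>A. ?u h a * (pmf p a - pmf q a)\<^sup>2"
  let ?W = "\<lambda>h\<^sub>0 (h\<^sub>1, h\<^sub>2). \<Sum>a\<in>A. ?u h\<^sub>0 a *
        count_diff I\<^sub>1 (fst \<circ> h\<^sub>1) (snd \<circ> h\<^sub>1) a * count_diff I\<^sub>2 (fst \<circ> h\<^sub>2) (snd \<circ> h\<^sub>2) a"
  have finpq: "finite (set_pmf p)" "finite (set_pmf q)" using finA finite_subset by blast+
  have finP: "finite (set_pmf (?P I\<^sub>0))"
    using finpq fin by (auto intro!: finite_set_Pi_pmf)
  have B: "1 - 1 / 10 \<le> measure_pmf.prob (?P I\<^sub>0) {h. ?B h < 20 / real (Suc (card I\<^sub>0))}"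
  proof -
    have "measure_pmf.prob (?P I\<^sub>0) {h. 20 / real (Suc (card I\<^sub>0)) \<le> ?B h} \<le>
        measure_pmf.expectation (?P I\<^sub>0) ?B / (20 / real (Suc (card I\<^sub>0)))"
      by (rule prob_Markov_pmf[OF finP]) (auto intro!: sum_nonneg simp: weight_pos less_imp_le)
    also have "\<dots> \<le> (2 / real (Suc (card I\<^sub>0))) / (20 / real (Suc (card I\<^sub>0)))"
      by (intro divide_right_mono expectation_weighted_l2 finA fin) auto
    also have "\<dots> = 1 / 10" by (simp del: of_nat_Suc)
    finally have "measure_pmf.prob (?P I\<^sub>0) {h. 20 / real (Suc (card I\<^sub>0)) \<le> ?B h} \<le> 1 / 10" .
    moreover have "measure_pmf.prob (?P I\<^sub>0) {h. ?B h < 20 / real (Suc (card I\<^sub>0))} =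
        1 - measure_pmf.prob (?P I\<^sub>0) {h. 20 / real (Suc (card I\<^sub>0)) \<le> ?B h}"
      by (subst measure_pmf.prob_compl[symmetric])
        (auto intro!: arg_cong[where f = "measure_pmf.prob (?P I\<^sub>0)"])
    ultimately show ?thesis by linarith
  qed
  have dev: "9 / 10 \<le> measure_pmf.prob (pair_pmf (?P I\<^sub>1) (?P I\<^sub>2))
      {z. \<bar>?W h z - real r ^ 2 * ?D h\<bar> < real r ^ 2 * D' / 2}"
    if h: "?B h < 20 / real (Suc (card I\<^sub>0))" and "D\<^sub>0 \<le> D'" "?D h \<le> D'" for h D'
  proof -
    have "15625 * ?B h \<le> 15625 * (20 / real (Suc (card I\<^sub>0)))"
      using h by (intro mult_left_mono) auto
    then have "15625 * ?B h \<le> (real r * D\<^sub>0)\<^sup>2" using D\<^sub>0 by simp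
    from closeness_deviation[OF finA _ _ fin(2) r(1) fin(3) r(2) this D\<^sub>0(1) that(2,3) r(3)]
    show ?thesis by (simp add: weight_pos less_imp_le weight_le_1 split_def)
  qed
  \<comment> \<open>\<open>Q\<close> stands for acceptance or rejection; either way it remains to
    treat fixed weights of small norm.\<close>
  have step: "81 / 100 \<le> measure_pmf.prob M {(f, g). Q (closeness_statistic A I\<^sub>0 I\<^sub>1 I\<^sub>2 f g)}"
    if "\<And>h. ?B h < 20 / real (Suc (card I\<^sub>0)) \<Longrightarrow>
      9 / 10 \<le> measure_pmf.prob (pair_pmf (?P I\<^sub>1) (?P I\<^sub>2)) {z. Q (?W h z)}" for Q
  proof -
    have "measure_pmf.prob M {(f, g). Q (closeness_statistic A I\<^sub>0 I\<^sub>1 I\<^sub>2 f g)} =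
        measure_pmf.prob (map_pmf (\<lambda>(f, g). closeness_statistic A I\<^sub>0 I\<^sub>1 I\<^sub>2 f g) M) {x. Q x}"
      by (simp add: vimage_def split_def)
    also have "\<dots> = measure_pmf.prob (bind_pmf (?P I\<^sub>0) (\<lambda>h. map_pmf (?W h) (pair_pmf (?P I\<^sub>1) (?P I\<^sub>2)))) {x. Q x}"
      unfolding M_def by (subst closeness_statistic_blocks[OF fin dis]) (rule refl)
    also have "\<dots> \<ge> (1 - 1 / 10) * (9 / 10)"
      by (rule prob_bind_ge[OF finP B]) (use that in \<open>auto simp: vimage_def\<close>)
    finally show ?thesis by simp
  qed
  show "81 / 100 \<le> measure_pmf.prob M {(f, g). closeness_statistic A I\<^sub>0 I\<^sub>1 I\<^sub>2 f g \<le> real r ^ 2 * D\<^sub>0 / 2}"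
    if "p = q"
  proof (rule step)
    fix h assume h: "?B h < 20 / real (Suc (card I\<^sub>0))"
    have "?D h = 0" using that by simp
    with dev[OF h, of D\<^sub>0] D\<^sub>0 have "9 / 10 \<le> measure_pmf.prob (pair_pmf (?P I\<^sub>1) (?P I\<^sub>2))
        {z. \<bar>?W h z\<bar> < real r ^ 2 * D\<^sub>0 / 2}" by simp
    also have "\<dots> \<le> measure_pmf.prob (pair_pmf (?P I\<^sub>1) (?P I\<^sub>2)) {z. ?W h z \<le> real r ^ 2 * D\<^sub>0 / 2}"
      by (intro measure_pmf.finite_measure_mono) auto
    finally show "9 / 10 \<le> measure_pmf.prob (pair_pmf (?P I\<^sub>1) (?P I\<^sub>2)) {z. ?W h z \<le> real r ^ 2 * D\<^sub>0 / 2}" .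
  qed
  show "81 / 100 \<le> measure_pmf.prob M {(f, g). \<not> closeness_statistic A I\<^sub>0 I\<^sub>1 I\<^sub>2 f g \<le> real r ^ 2 * D\<^sub>0 / 2}"
    if S: "S \<subseteq> A" "D\<^sub>0 * (real (card S) + 2 * real (card I\<^sub>0)) \<le> (\<Sum>a\<in>S. \<bar>pmf p a - pmf q a\<bar>)\<^sup>2"
      "0 < card S + card I\<^sub>0" for S
  proof (rule step)
    fix h assume h: "?B h < 20 / real (Suc (card I\<^sub>0))"
    have "D\<^sub>0 * (real (card S) + 2 * real (card I\<^sub>0)) \<le> (real (card S) + 2 * real (card I\<^sub>0)) * ?D h"
      using S(2) weighted_l2_ge[OF finA(1) S(1) fin(1)] by (rule order_trans)
    then have D: "D\<^sub>0 \<le> ?D h"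
      using S(3) by (simp add: mult.commute[of D\<^sub>0])
    then have le: "real r ^ 2 * D\<^sub>0 \<le> real r ^ 2 * ?D h"
      by (intro mult_left_mono) auto
    \<comment> \<open>With the weighted distance itself as \<open>D'\<close>, the statistic exceeds
      half its own mean, which is at least the threshold.\<close>
    from dev[OF h D] have "9 / 10 \<le> measure_pmf.prob (pair_pmf (?P I\<^sub>1) (?P I\<^sub>2))
        {z. \<bar>?W h z - real r ^ 2 * ?D h\<bar> < real r ^ 2 * ?D h / 2}" by simp
    also have "\<dots> \<le> measure_pmf.prob (pair_pmf (?P I\<^sub>1) (?P I\<^sub>2)) {z. \<not> ?W h z \<le> real r ^ 2 * D\<^sub>0 / 2}"
      using le by (intro measure_pmf.finite_measure_mono) (auto simp: abs_real_def split: if_splits)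
    finally show "9 / 10 \<le> measure_pmf.prob (pair_pmf (?P I\<^sub>1) (?P I\<^sub>2)) {z. \<not> ?W h z \<le> real r ^ 2 * D\<^sub>0 / 2}" .
  qed
qed

subsection \<open>Transport plans and projections\<close>

lemma finite_cube: "finite (cube n)"
  using finite_lists_length_eq[of "UNIV :: bool set" n] by (simp add: cube_def)

lemma rel_hamming_commute: "rel_hamming n x y = rel_hamming n y x"
  unfolding rel_hamming_def by (metis (no_types))

lemma rel_hamming_nonneg: "0 \<le> rel_hamming n x y"
  by (simp add: rel_hamming_def)

lemma rel_hamming_le_1: "rel_hamming n x y \<le> 1"
proof -
  have "card {i. i < n \<and> x ! i \<noteq> y ! i} \<le> card {..<n}"
    by (intro card_mono) auto
  then show ?thesis by (cases "n = 0") (simp_all add: rel_hamming_def divide_le_eq_1)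
qed

lemma emd_le:
  assumes "transport_plan n X Y w"
  shows "emd n X Y \<le> (\<Sum>x\<in>cube n. \<Sum>y\<in>cube n. w x y * rel_hamming n x y)"
  unfolding emd_def
proof (rule cINF_lower)
  show "bdd_below ((\<lambda>w. \<Sum>x\<in>cube n. \<Sum>y\<in>cube n. w x y * rel_hamming n x y) ` {w. transport_plan n X Y w})"
    by (rule bdd_belowI2[of _ 0])
      (auto simp: transport_plan_def rel_hamming_nonneg intro!: sum_nonneg mult_nonneg_nonneg)
qed (use assms in simp)

lemma emd_commute: "emd n X Y = emd n Y X"
proof -
  define c :: "(bool list \<Rightarrow> bool list \<Rightarrow> real) \<Rightarrow> real"
    where "c = (\<lambda>w. \<Sum>x\<in>cube n. \<Sum>y\<in>cube n. w x y * rel_hamming n x y)"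
  have c: "c (\<lambda>x y. w y x) = c w" for w
    unfolding c_def by (subst sum.swap) (simp add: rel_hamming_commute)
  have tp: "transport_plan n X Y w \<Longrightarrow> transport_plan n Y X (\<lambda>x y. w y x)" for X Y w
    by (auto simp: transport_plan_def)
  have "c ` {w. transport_plan n X Y w} \<subseteq> c ` {w. transport_plan n Y X w}" for X Y
  proof
    fix v assume "v \<in> c ` {w. transport_plan n X Y w}"
    then obtain w where "transport_plan n X Y w" "v = c w" by auto
    then have "v = c (\<lambda>x y. w y x)" "transport_plan n Y X (\<lambda>x y. w y x)"
      using c[of w] tp[of X Y w] by auto
    then show "v \<in> c ` {w. transport_plan n Y X w}" by blast
  qed
  then have "c ` {w. transport_plan n X Y w} = c ` {w. transport_plan n Y X w}" by blast
  then show ?thesis by (simp add: emd_def c_def)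
qed

lemma transport_plan_product:
  assumes X: "set_pmf X \<subseteq> cube n" and Y: "set_pmf Y \<subseteq> cube n"
  shows "transport_plan n X Y (\<lambda>x y. pmf X x * pmf Y y)"
  using sum_pmf_eq_1[OF finite_cube X] sum_pmf_eq_1[OF finite_cube Y]
  by (simp add: transport_plan_def sum_distrib_left[symmetric] sum_distrib_right[symmetric])

lemma emd_le_1:
  assumes X: "set_pmf X \<subseteq> cube n" and Y: "set_pmf Y \<subseteq> cube n"
  shows "emd n X Y \<le> 1"
proof -
  let ?w = "\<lambda>x y. pmf X x * pmf Y y"
  have "emd n X Y \<le> (\<Sum>x\<in>cube n. \<Sum>y\<in>cube n. ?w x y * rel_hamming n x y)"
    by (rule emd_le[OF transport_plan_product[OF X Y]])
  also have "\<dots> \<le> (\<Sum>x\<in>cube n. \<Sum>y\<in>cube n. ?w x y * 1)"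
    by (intro sum_mono mult_left_mono rel_hamming_le_1) auto
  also have "\<dots> = 1"
    using sum_pmf_eq_1[OF finite_cube X] sum_pmf_eq_1[OF finite_cube Y]
    by (simp add: sum_distrib_left[symmetric])
  finally show ?thesis .
qed

lemma emd_0_le_0:
  assumes "set_pmf X \<subseteq> cube 0" "set_pmf Y \<subseteq> cube 0"
  shows "emd 0 X Y \<le> 0"
  using emd_le[OF transport_plan_product[OF assms]] by (simp add: rel_hamming_def)

lemma pmf_map_eq_sum:
  assumes "finite A" "set_pmf p \<subseteq> A"
  shows "pmf (map_pmf f p) c = (\<Sum>x\<in>{x \<in> A. f x = c}. pmf p x)"
proof -
  have "pmf (map_pmf f p) c = measure_pmf.prob p (f -` {c})" by (simp add: pmf_map)
  also have "\<dots> = measure_pmf.prob p {x \<in> A. f x = c}"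
    using assms by (intro measure_prob_cong_0) (auto simp: set_pmf_eq)
  also have "\<dots> = (\<Sum>x\<in>{x \<in> A. f x = c}. pmf p x)"
    using assms by (simp add: measure_measure_pmf_finite)
  finally show ?thesis .
qed

text \<open>An optimal coupling of the images under \<open>\<pi>\<close> lifts to a transport plan of \<open>X\<close> and \<open>Y\<close>:
  within a fibre mass is moved proportionally, and the mass that the images do not share is moved
  arbitrarily. The lifted plan pays at most 1 for unshared mass and for collisions of distant points.\<close>

lemma emd_le_projection:
  assumes X: "set_pmf X \<subseteq> cube n" and Y: "set_pmf Y \<subseteq> cube n"
    and A: "finite A" "\<pi> ` cube n \<subseteq> A" and "0 \<le> \<eta>"
  defines "p \<equiv> map_pmf \<pi> X" and "q \<equiv> map_pmf \<pi> Y"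
  shows "emd n X Y \<le> (\<Sum>c\<in>A. max 0 (pmf p c - pmf q c)) + \<eta> +
    measure_pmf.prob Y {y. \<exists>x\<in>set_pmf X. \<eta> < rel_hamming n x y \<and> \<pi> x = \<pi> y}"
proof -
  \<comment> \<open>\<open>\<mu> c\<close> is the mass that a maximal coupling of the images keeps
    at \<open>c\<close>; \<open>w\<close> spreads it over the fibre as the product of the
    conditional distributions.\<close>
  define \<mu> where "\<mu> = (\<lambda>c. min (pmf p c) (pmf q c))"
  define w where "w = (\<lambda>x y. if \<pi> x = \<pi> y then \<mu> (\<pi> x) * (pmf X x / pmf p (\<pi> x)) * (pmf Y y / pmf q (\<pi> y)) else 0)"
  define R where "R = (\<lambda>x. pmf X x - (\<Sum>y\<in>cube n. w x y))"
  define R' where "R' = (\<lambda>y. pmf Y y - (\<Sum>x\<in>cube n. w x y))"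
  define \<tau> where "\<tau> = (\<Sum>c\<in>A. max 0 (pmf p c - pmf q c))"
  have w0: "0 \<le> w x y" for x y
    by (auto simp: w_def \<mu>_def)
  have p: "pmf p c = (\<Sum>x\<in>{x \<in> cube n. \<pi> x = c}. pmf X x)"
    and q: "pmf q c = (\<Sum>x\<in>{x \<in> cube n. \<pi> x = c}. pmf Y x)" for c
    unfolding p_def q_def using X Y by (simp_all add: pmf_map_eq_sum finite_cube)
  have row: "(\<Sum>y\<in>cube n. w x y) = \<mu> (\<pi> x) * (pmf X x / pmf p (\<pi> x))" for x
  proof -
    have "(\<Sum>y\<in>cube n. w x y) = (\<Sum>y\<in>{y \<in> cube n. \<pi> y = \<pi> x}. w x y)"
      using finite_cube by (intro sum.mono_neutral_right) (auto simp: w_def)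
    also have "\<dots> = (\<Sum>y\<in>{y \<in> cube n. \<pi> y = \<pi> x}. \<mu> (\<pi> x) * (pmf X x / pmf p (\<pi> x)) / pmf q (\<pi> x) * pmf Y y)"
      by (intro sum.cong) (auto simp: w_def)
    also have "\<dots> = \<mu> (\<pi> x) * (pmf X x / pmf p (\<pi> x)) / pmf q (\<pi> x) * pmf q (\<pi> x)"
      by (simp add: sum_distrib_left q)
    \<comment> \<open>Where \<open>pmf q\<close> vanishes, so does the minimum \<open>\<mu>\<close>,
      and division by zero does no harm.\<close>
    also have "\<dots> = \<mu> (\<pi> x) * (pmf X x / pmf p (\<pi> x))"
      by (cases "pmf q (\<pi> x) = 0") (simp_all add: \<mu>_def)
    finally show ?thesis .
  qed
  have col: "(\<Sum>x\<in>cube n. w x y) = \<mu> (\<pi> y) * (pmf Y y / pmf q (\<pi> y))" for y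
  proof -
    have "(\<Sum>x\<in>cube n. w x y) = (\<Sum>x\<in>{x \<in> cube n. \<pi> x = \<pi> y}. w x y)"
      using finite_cube by (intro sum.mono_neutral_right) (auto simp: w_def)
    also have "\<dots> = (\<Sum>x\<in>{x \<in> cube n. \<pi> x = \<pi> y}. \<mu> (\<pi> y) * (pmf Y y / pmf q (\<pi> y)) / pmf p (\<pi> y) * pmf X x)"
      by (intro sum.cong) (auto simp: w_def mult_ac)
    also have "\<dots> = \<mu> (\<pi> y) * (pmf Y y / pmf q (\<pi> y)) / pmf p (\<pi> y) * pmf p (\<pi> y)"
      by (simp add: sum_distrib_left p)
    also have "\<dots> = \<mu> (\<pi> y) * (pmf Y y / pmf q (\<pi> y))"
      by (cases "pmf p (\<pi> y) = 0") (simp_all add: \<mu>_def)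
    finally show ?thesis .
  qed
  have scaled: "min a b * (c / a) \<le> c" if "0 \<le> a" "0 \<le> b" "0 \<le> c" for a b c :: real
  proof (cases "a = 0")
    case False
    then have "min a b / a * c \<le> 1 * c"
      using that by (intro mult_right_mono) (auto simp: divide_le_eq_1)
    then show ?thesis by simp
  qed (use that in simp)
  have row_le: "(\<Sum>y\<in>cube n. w x y) \<le> pmf X x" for x
    unfolding row \<mu>_def by (rule scaled) auto
  have col_le: "(\<Sum>x\<in>cube n. w x y) \<le> pmf Y y" for y
    unfolding col \<mu>_def min.commute[of "pmf p _"] by (rule scaled) auto
  have R0: "0 \<le> R x" "0 \<le> R' x" for x
    using row_le col_le by (simp_all add: R_def R'_def)
  have sX: "(\<Sum>x\<in>cube n. pmf X x) = 1" and sY: "(\<Sum>x\<in>cube n. pmf Y x) = 1"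
    using X Y by (simp_all add: sum_pmf_eq_1 finite_cube)
  \<comment> \<open>Both residuals are what \<open>w\<close> leaves of a total mass of 1.\<close>
  have RR': "sum R' (cube n) = sum R (cube n)"
    unfolding R_def R'_def sum_subtractf sX sY by (subst sum.swap) simp
  have sR: "sum R (cube n) = \<tau>"
  proof -
    have fibre: "(\<Sum>x\<in>{x \<in> cube n. \<pi> x = c}. R x) = max 0 (pmf p c - pmf q c)" for c
    proof -
      have "(\<Sum>x\<in>{x \<in> cube n. \<pi> x = c}. R x) =
          (\<Sum>x\<in>{x \<in> cube n. \<pi> x = c}. pmf X x - \<mu> c / pmf p c * pmf X x)"
        by (intro sum.cong refl) (auto simp: R_def row)
      also have "\<dots> = pmf p c - \<mu> c / pmf p c * pmf p c"
        by (simp add: sum_subtractf p sum_distrib_left)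
      also have "\<dots> = max 0 (pmf p c - pmf q c)"
        by (cases "pmf p c = 0") (auto simp: \<mu>_def)
      finally show ?thesis .
    qed
    have "(\<Sum>x\<in>cube n. R x) = (\<Sum>c\<in>A. \<Sum>x\<in>{x \<in> cube n. \<pi> x = c}. R x)"
      using A finite_cube by (intro sum.group[symmetric]) auto
    then show ?thesis by (simp add: fibre \<tau>_def)
  qed
  have \<tau>0: "0 \<le> \<tau>" by (simp add: \<tau>_def sum_nonneg)
  have z: "R x = 0" "R' x = 0" if "\<tau> = 0" "x \<in> cube n" for x
    using that sum_nonneg_eq_0_iff[OF finite_cube, of n R] sum_nonneg_eq_0_iff[OF finite_cube, of n R'] R0 sR RR'
    by simp_all
  \<comment> \<open>The residuals have the same total mass \<tau>, so their product divided by
    \<tau> couples them. For \<tau> = 0 they vanish on the cube by \<open>z\<close>, and the added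
    term is 0.\<close>
  define v where "v = (\<lambda>x y. w x y + R x * R' y / \<tau>)"
  have v_row: "(\<Sum>y\<in>cube n. v x y) = pmf X x" if "x \<in> cube n" for x
  proof -
    have "(\<Sum>y\<in>cube n. v x y) = (\<Sum>y\<in>cube n. w x y) + R x * (sum R' (cube n) / \<tau>)"
      by (simp add: v_def sum.distrib sum_distrib_left sum_divide_distrib)
    also have "R x * (sum R' (cube n) / \<tau>) = R x"
      using z(1)[OF _ that] by (cases "\<tau> = 0") (simp_all add: RR' sR)
    finally show ?thesis by (simp add: R_def)
  qed
  have v_col: "(\<Sum>x\<in>cube n. v x y) = pmf Y y" if "y \<in> cube n" for y
  proof -
    have "(\<Sum>x\<in>cube n. v x y) = (\<Sum>x\<in>cube n. w x y) + (sum R (cube n) / \<tau>) * R' y"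
      by (simp add: v_def sum.distrib sum_distrib_left sum_divide_distrib sum_distrib_right)
    also have "(sum R (cube n) / \<tau>) * R' y = R' y"
      using z(2)[OF _ that] by (cases "\<tau> = 0") (simp_all add: sR)
    finally show ?thesis by (simp add: R'_def)
  qed
  have "transport_plan n X Y v"
    unfolding transport_plan_def using v_row v_col w0 R0 \<tau>0 by (simp add: v_def)
  then have "emd n X Y \<le> (\<Sum>x\<in>cube n. \<Sum>y\<in>cube n. v x y * rel_hamming n x y)"
    by (rule emd_le)
  also have "\<dots> = (\<Sum>x\<in>cube n. \<Sum>y\<in>cube n. R x * R' y / \<tau> * rel_hamming n x y) +
      (\<Sum>x\<in>cube n. \<Sum>y\<in>cube n. w x y * rel_hamming n x y)"
    by (simp add: v_def distrib_right sum.distrib)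
  also have "(\<Sum>x\<in>cube n. \<Sum>y\<in>cube n. R x * R' y / \<tau> * rel_hamming n x y) \<le> \<tau>"
  proof -
    have "(\<Sum>x\<in>cube n. \<Sum>y\<in>cube n. R x * R' y / \<tau> * rel_hamming n x y) \<le>
        (\<Sum>x\<in>cube n. \<Sum>y\<in>cube n. R x * R' y / \<tau> * 1)"
      using R0 \<tau>0 by (intro sum_mono mult_left_mono rel_hamming_le_1) auto
    also have "\<dots> = sum R (cube n) * sum R' (cube n) / \<tau>"
      by (simp add: sum_product sum_divide_distrib)
    finally show ?thesis by (simp add: RR' sR split: if_splits)
  qed
  also have "(\<Sum>x\<in>cube n. \<Sum>y\<in>cube n. w x y * rel_hamming n x y) \<le>
      \<eta> + measure_pmf.prob Y {y. \<exists>x\<in>set_pmf X. \<eta> < rel_hamming n x y \<and> \<pi> x = \<pi> y}"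
  proof -
    let ?bad = "\<lambda>y. \<exists>x\<in>set_pmf X. \<eta> < rel_hamming n x y \<and> \<pi> x = \<pi> y"
    \<comment> \<open>\<open>w\<close> is nonzero only on pairs with equal images and
      \<open>x\<close> in the support of \<open>X\<close>. Such a pair is farther apart than \<eta>
      only if \<open>y\<close> is bad, and its distance never exceeds 1.\<close>
    have "w x y * rel_hamming n x y \<le> w x y * (\<eta> + of_bool (?bad y))" for x y
    proof (cases "w x y = 0")
      case False
      then have "\<pi> x = \<pi> y" "x \<in> set_pmf X"
        by (auto simp: w_def set_pmf_eq split: if_splits)
      then have "rel_hamming n x y \<le> \<eta> + of_bool (?bad y)"
        using rel_hamming_le_1[of n x y] \<open>0 \<le> \<eta>\<close> by (cases "?bad y") (auto simp: not_less)
      then show ?thesis using w0 by (rule mult_left_mono)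
    qed simp
    then have "(\<Sum>x\<in>cube n. \<Sum>y\<in>cube n. w x y * rel_hamming n x y) \<le>
        (\<Sum>x\<in>cube n. \<Sum>y\<in>cube n. w x y * (\<eta> + of_bool (?bad y)))"
      by (intro sum_mono)
    also have "\<dots> = (\<Sum>y\<in>cube n. (\<Sum>x\<in>cube n. w x y) * (\<eta> + of_bool (?bad y)))"
      by (subst sum.swap) (simp only: sum_distrib_right)
    also have "\<dots> \<le> (\<Sum>y\<in>cube n. pmf Y y * (\<eta> + of_bool (?bad y)))"
      using \<open>0 \<le> \<eta>\<close> by (intro sum_mono mult_right_mono col_le) auto
    also have "\<dots> = \<eta> + (\<Sum>y\<in>cube n. pmf Y y * of_bool (?bad y))"
      by (simp add: distrib_left sum.distrib sum_distrib_right[symmetric] sY)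
    also have "(\<Sum>y\<in>cube n. pmf Y y * of_bool (?bad y)) = (\<Sum>y\<in>{y \<in> cube n. ?bad y}. pmf Y y)"
      using finite_cube by (intro sum.mono_neutral_cong_right) auto
    also have "\<dots> = measure_pmf.prob Y {y \<in> cube n. ?bad y}"
      using finite_cube by (simp add: measure_measure_pmf_finite)
    also have "\<dots> \<le> measure_pmf.prob Y {y. ?bad y}"
      by (intro measure_pmf.finite_measure_mono) auto
    finally show ?thesis by simp
  qed
  finally show ?thesis by (simp add: \<tau>_def)
qed

subsection \<open>Restriction to random positions\<close>

definition restrict_to :: "nat \<Rightarrow> (nat \<Rightarrow> nat) \<Rightarrow> bool list \<Rightarrow> bool list" where
  "restrict_to l J x = map (\<lambda>i. x ! J i) [0..<l]"

text \<open>Positions are drawn with replacement, so the collision probability of two strings is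
  exactly the \<open>l\<close>-th power of their fraction of agreeing positions.\<close>

definition random_positions :: "nat \<Rightarrow> nat \<Rightarrow> (nat \<Rightarrow> nat) pmf" where
  "random_positions n l = Pi_pmf {..<l} 0 (\<lambda>_. pmf_of_set {..<n})"

lemma restrict_to_in_cube: "restrict_to l J x \<in> cube l"
  by (simp add: restrict_to_def cube_def)

lemma random_positions_less:
  assumes "0 < n" "J \<in> set_pmf (random_positions n l)" "i < l"
  shows "J i < n"
proof -
  have "J \<in> PiE_dflt {..<l} 0 (set_pmf \<circ> (\<lambda>_. pmf_of_set {..<n}))"
    using assms(2) by (simp add: random_positions_def set_Pi_pmf)
  then have "J i \<in> set_pmf (pmf_of_set {..<n})"
    using assms(3) by (auto simp: PiE_dflt_def)
  moreover have "{..<n} \<noteq> {}" using assms(1) by auto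
  ultimately show ?thesis by (simp add: set_pmf_of_set)
qed

lemma finite_random_positions:
  assumes "0 < n"
  shows "finite (set_pmf (random_positions n l))"
proof -
  have "{..<n} \<noteq> {}" using assms by auto
  then show ?thesis
    unfolding random_positions_def by (intro finite_set_Pi_pmf) (auto simp: set_pmf_of_set)
qed

lemma prob_restrict_to_collision:
  assumes "0 < n"
  shows "measure_pmf.prob (random_positions n l) {J. restrict_to l J x = restrict_to l J y} =
    (1 - rel_hamming n x y) ^ l"
proof -
  have ne: "{..<n} \<noteq> {}" using assms by auto
  let ?S = "{i. i < n \<and> x ! i \<noteq> y ! i}"
  have "{..<n} \<inter> {i. x ! i = y ! i} = {..<n} - ?S" by auto
  moreover have "card ({..<n} - ?S) = n - card ?S" by (subst card_Diff_subset) auto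
  moreover have "card ?S \<le> card {..<n}" by (intro card_mono) auto
  ultimately have "real (card ({..<n} \<inter> {i. x ! i = y ! i})) = real n - real (card ?S)" by simp
  then have one: "measure_pmf.prob (pmf_of_set {..<n}) {i. x ! i = y ! i} = 1 - rel_hamming n x y"
    using assms ne by (simp add: measure_pmf_of_set rel_hamming_def field_simps)
  have "{J. restrict_to l J x = restrict_to l J y} = Pi {..<l} (\<lambda>_. {i. x ! i = y ! i})"
    by (auto simp: restrict_to_def Pi_def)
  then show ?thesis
    unfolding random_positions_def by (simp add: measure_Pi_pmf_Pi one)
qed

text \<open>For each fixed \<open>y\<close>, a union bound over the support of \<open>X\<close>;
  then the average over \<open>Y\<close>. The support of \<open>Y\<close> may thus be arbitrarily
  large within the cube.\<close>

lemma expected_distant_collisions: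
  assumes "0 < n" and X: "finite (set_pmf X)" and Y: "finite (set_pmf Y)" and "0 \<le> \<eta>" "\<eta> \<le> 1"
  shows "measure_pmf.expectation (random_positions n l) (\<lambda>J. measure_pmf.prob Y
      {y. \<exists>x\<in>set_pmf X. \<eta> < rel_hamming n x y \<and> restrict_to l J x = restrict_to l J y})
    \<le> real (card (set_pmf X)) * (1 - \<eta>) ^ l"
proof -
  let ?R = "random_positions n l"
  let ?bad = "\<lambda>J y. \<exists>x\<in>set_pmf X. \<eta> < rel_hamming n x y \<and> restrict_to l J x = restrict_to l J y"
  note [simp] = integrable_measure_pmf_finite[OF finite_random_positions[OF assms(1), of l]]
  have bad: "measure_pmf.prob ?R {J. ?bad J y} \<le> real (card (set_pmf X)) * (1 - \<eta>) ^ l" for y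
  proof -
    let ?F = "{x \<in> set_pmf X. \<eta> < rel_hamming n x y}"
    have "measure_pmf.prob ?R {J. ?bad J y} =
        measure_pmf.prob ?R (\<Union>x\<in>?F. {J. restrict_to l J x = restrict_to l J y})"
      by (intro arg_cong[where f = "measure_pmf.prob ?R"]) auto
    also have "\<dots> \<le> (\<Sum>x\<in>?F. measure_pmf.prob ?R {J. restrict_to l J x = restrict_to l J y})"
      using X by (intro measure_pmf.finite_measure_subadditive_finite) auto
    also have "\<dots> \<le> (\<Sum>x\<in>?F. (1 - \<eta>) ^ l)"
      using assms(1) rel_hamming_le_1
      by (intro sum_mono) (auto simp: prob_restrict_to_collision intro!: power_mono)
    also have "\<dots> = real (card ?F) * (1 - \<eta>) ^ l" by simp
    also have "\<dots> \<le> real (card (set_pmf X)) * (1 - \<eta>) ^ l"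
      using X assms(5) by (intro mult_right_mono) (auto intro!: card_mono)
    finally show ?thesis .
  qed
  have "measure_pmf.expectation ?R (\<lambda>J. measure_pmf.prob Y {y. ?bad J y}) =
      measure_pmf.expectation ?R (\<lambda>J. \<Sum>y\<in>set_pmf Y. pmf Y y * indicator {J. ?bad J y} J)"
  proof (intro Bochner_Integration.integral_cong refl)
    fix J
    have "measure_pmf.prob Y {y. ?bad J y} = measure_pmf.prob Y {y \<in> set_pmf Y. ?bad J y}"
      by (intro measure_prob_cong_0) (auto simp: set_pmf_eq)
    also have "\<dots> = (\<Sum>y\<in>{y \<in> set_pmf Y. ?bad J y}. pmf Y y)"
      using Y by (simp add: measure_measure_pmf_finite)
    also have "\<dots> = (\<Sum>y\<in>set_pmf Y. pmf Y y * indicator {J. ?bad J y} J)"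
      using Y by (intro sum.mono_neutral_cong_left) auto
    finally show "measure_pmf.prob Y {y. ?bad J y} =
        (\<Sum>y\<in>set_pmf Y. pmf Y y * indicator {J. ?bad J y} J)" .
  qed
  also have "\<dots> = (\<Sum>y\<in>set_pmf Y. pmf Y y * measure_pmf.prob ?R {J. ?bad J y})"
    by simp
  also have "\<dots> \<le> (\<Sum>y\<in>set_pmf Y. pmf Y y * (real (card (set_pmf X)) * (1 - \<eta>) ^ l))"
    by (intro sum_mono mult_left_mono bad) auto
  also have "\<dots> = real (card (set_pmf X)) * (1 - \<eta>) ^ l"
    using sum_pmf_eq_1[OF Y order_refl] by (simp add: sum_distrib_right[symmetric])
  finally show ?thesis .
qed

text \<open>The gap has to be visible on at most \<open>m\<close> points, so that
  \<open>weighted_l2_ge\<close> costs a factor of order \<open>m\<close> even if one support is much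
  larger. The absolute value makes the notion symmetric.\<close>

definition separated :: "nat \<Rightarrow> nat \<Rightarrow> real \<Rightarrow> bool list pmf \<Rightarrow> bool list pmf \<Rightarrow> bool" where
  "separated l m \<theta> p q \<longleftrightarrow> (\<exists>S\<subseteq>cube l. card S \<le> m \<and> \<theta> \<le> (\<Sum>c\<in>S. \<bar>pmf p c - pmf q c\<bar>))"

lemma separated_commute: "separated l m \<theta> p q \<longleftrightarrow> separated l m \<theta> q p"
  by (simp add: separated_def abs_minus_commute)

text \<open>With probability at least \<open>9 / 10\<close> the collision term is below
  \<open>\<epsilon> / 4\<close>, by Markov's inequality with mean at most
  \<open>\<epsilon> / 40\<close>. Then \<open>emd_le_projection\<close> with \<eta> =
  \<open>\<epsilon> / 2\<close> leaves at least \<open>\<epsilon> / 4\<close> for the one-sided gap.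
  That gap lives where the image of \<open>X\<close> is the heavier one, hence on at most
  \<open>m\<close> points.\<close>

lemma restriction_separates_left:
  assumes "0 < n" "0 < \<epsilon>" "\<epsilon> < 1" and X: "set_pmf X \<subseteq> cube n" and Y: "set_pmf Y \<subseteq> cube n"
    and m: "card (set_pmf X) \<le> m" and far: "eps_far n \<epsilon> X Y"
    and l: "real m * (1 - \<epsilon> / 2) ^ l \<le> \<epsilon> / 40"
  shows "9 / 10 \<le> measure_pmf.prob (random_positions n l)
    {J. separated l m (\<epsilon> / 4) (map_pmf (restrict_to l J) X) (map_pmf (restrict_to l J) Y)}"
proof -
  let ?R = "random_positions n l"
  let ?bad = "\<lambda>J. measure_pmf.prob Y
      {y. \<exists>x\<in>set_pmf X. \<epsilon> / 2 < rel_hamming n x y \<and> restrict_to l J x = restrict_to l J y}"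
  have fin: "finite (set_pmf X)" "finite (set_pmf Y)"
    using X Y finite_cube finite_subset by blast+
  have "measure_pmf.prob ?R {J. \<epsilon> / 4 \<le> ?bad J} \<le> measure_pmf.expectation ?R ?bad / (\<epsilon> / 4)"
    using assms by (intro prob_Markov_pmf finite_random_positions) auto
  also have "\<dots> \<le> (real (card (set_pmf X)) * (1 - \<epsilon> / 2) ^ l) / (\<epsilon> / 4)"
    using assms fin by (intro divide_right_mono expected_distant_collisions) auto
  also have "\<dots> \<le> (\<epsilon> / 40) / (\<epsilon> / 4)"
  proof (rule divide_right_mono)
    have "real (card (set_pmf X)) * (1 - \<epsilon> / 2) ^ l \<le> real m * (1 - \<epsilon> / 2) ^ l"
      using m assms by (intro mult_right_mono) auto
    then show "real (card (set_pmf X)) * (1 - \<epsilon> / 2) ^ l \<le> \<epsilon> / 40" using l by linarith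
  qed (use assms in simp)
  also have "\<dots> = 1 / 10" using assms by simp
  finally have "measure_pmf.prob ?R {J. \<epsilon> / 4 \<le> ?bad J} \<le> 1 / 10" .
  moreover have "measure_pmf.prob ?R {J. ?bad J < \<epsilon> / 4} = 1 - measure_pmf.prob ?R {J. \<epsilon> / 4 \<le> ?bad J}"
    by (subst measure_pmf.prob_compl[symmetric]) (auto intro!: arg_cong[where f = "measure_pmf.prob ?R"])
  ultimately have "9 / 10 \<le> measure_pmf.prob ?R {J. ?bad J < \<epsilon> / 4}" by linarith
  also have "\<dots> \<le> measure_pmf.prob ?R
      {J. separated l m (\<epsilon> / 4) (map_pmf (restrict_to l J) X) (map_pmf (restrict_to l J) Y)}"
  proof (intro measure_pmf.finite_measure_mono subsetI CollectI)
    fix J assume "J \<in> {J. ?bad J < \<epsilon> / 4}"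
    then have bad: "?bad J < \<epsilon> / 4" by simp
    let ?p = "map_pmf (restrict_to l J) X" and ?q = "map_pmf (restrict_to l J) Y"
    let ?S = "{c \<in> cube l. pmf ?q c < pmf ?p c}"
    have "emd n X Y \<le> (\<Sum>c\<in>cube l. max 0 (pmf ?p c - pmf ?q c)) + \<epsilon> / 2 + ?bad J"
      using assms by (intro emd_le_projection X Y finite_cube) (auto simp: restrict_to_in_cube)
    also have "(\<Sum>c\<in>cube l. max 0 (pmf ?p c - pmf ?q c)) = (\<Sum>c\<in>?S. \<bar>pmf ?p c - pmf ?q c\<bar>)"
      using finite_cube by (intro sum.mono_neutral_cong_right) auto
    finally have "\<epsilon> / 4 \<le> (\<Sum>c\<in>?S. \<bar>pmf ?p c - pmf ?q c\<bar>)"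
      using far bad by (simp add: eps_far_def)
    moreover have "card ?S \<le> m"
    proof -
      have "?S \<subseteq> set_pmf ?p" by (auto simp: set_pmf_eq simp del: set_map_pmf)
      then have "card ?S \<le> card (restrict_to l J ` set_pmf X)"
        using fin by (intro card_mono) auto
      also have "\<dots> \<le> card (set_pmf X)" using fin by (intro card_image_le)
      finally show ?thesis using m by simp
    qed
    ultimately show "separated l m (\<epsilon> / 4) ?p ?q"
      unfolding separated_def by (intro exI[of _ ?S]) auto
  qed simp
  finally show ?thesis .
qed

lemma restriction_separates:
  assumes "0 < n" "0 < \<epsilon>" "\<epsilon> < 1" "set_pmf X \<subseteq> cube n" "set_pmf Y \<subseteq> cube n"
    and "card (set_pmf X) \<le> m \<or> card (set_pmf Y) \<le> m" and far: "eps_far n \<epsilon> X Y"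
    and "real m * (1 - \<epsilon> / 2) ^ l \<le> \<epsilon> / 40"
  shows "9 / 10 \<le> measure_pmf.prob (random_positions n l)
    {J. separated l m (\<epsilon> / 4) (map_pmf (restrict_to l J) X) (map_pmf (restrict_to l J) Y)}"
  using assms(6)
proof
  assume "card (set_pmf Y) \<le> m"
  moreover have "eps_far n \<epsilon> Y X" using far by (simp add: eps_far_def emd_commute)
  ultimately show ?thesis
    using restriction_separates_left[of n \<epsilon> Y X m l] assms by (subst separated_commute) simp
qed (rule restriction_separates_left[OF assms(1-5) _ assms(7,8)])

section \<open>Decision trees that read a fixed list of bits\<close>

primrec read_tree :: "(source \<times> nat \<times> nat) list \<Rightarrow> (bool list \<Rightarrow> bool) \<Rightarrow> query_tree" where
  "read_tree [] g = Answer (g [])"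
| "read_tree (b # bs) g = Query (fst b) (fst (snd b)) (snd (snd b))
     (read_tree bs (\<lambda>v. g (False # v))) (read_tree bs (\<lambda>v. g (True # v)))"

definition bit_of :: "source \<times> nat \<times> nat \<Rightarrow> (nat \<Rightarrow> bool list) \<Rightarrow> (nat \<Rightarrow> bool list) \<Rightarrow> bool" where
  "bit_of b xs ys = (case b of (c, j, i) \<Rightarrow> case c of FromX \<Rightarrow> xs j ! i | FromY \<Rightarrow> ys j ! i)"

lemma verdict_read_tree: "verdict (read_tree bs g) xs ys = g (map (\<lambda>b. bit_of b xs ys) bs)"
proof (induction bs arbitrary: g)
  case (Cons b bs)
  obtain c j i where b: "b = (c, j, i)" by (cases b)
  show ?case
  proof (cases "bit_of b xs ys")
    case True
    then show ?thesis by (simp add: Cons.IH b bit_of_def)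
  next
    case False
    then show ?thesis by (simp add: Cons.IH b bit_of_def)
  qed
qed simp

lemma max_queries_read_tree: "max_queries (read_tree bs g) = length bs"
  by (induction bs arbitrary: g) simp_all

lemma well_formed_read_tree:
  "(\<And>c j i. (c, j, i) \<in> set bs \<Longrightarrow> j < s \<and> i < n) \<Longrightarrow> well_formed n s (read_tree bs g)"
proof (induction bs arbitrary: g)
  case (Cons b bs)
  obtain c j i where "b = (c, j, i)" by (cases b)
  then show ?case using Cons by auto
qed simp

text \<open>A predicate that is determined by the queried bits can be evaluated on any samples
  consistent with the answers.\<close>

definition decision_tree ::
  "(source \<times> nat \<times> nat) list \<Rightarrow> ((nat \<Rightarrow> bool list) \<Rightarrow> (nat \<Rightarrow> bool list) \<Rightarrow> bool) \<Rightarrow> query_tree" where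
  "decision_tree bs G =
     read_tree bs (\<lambda>v. \<exists>xs ys. map (\<lambda>b. bit_of b xs ys) bs = v \<and> G xs ys)"

lemma verdict_decision_tree:
  assumes "\<And>xs' ys'. (\<And>b. b \<in> set bs \<Longrightarrow> bit_of b xs' ys' = bit_of b xs ys) \<Longrightarrow> G xs' ys' = G xs ys"
  shows "verdict (decision_tree bs G) xs ys = G xs ys"
  using assms unfolding decision_tree_def verdict_read_tree map_eq_conv by blast

subsection \<open>The tester\<close>

definition accepts :: "nat \<Rightarrow> nat \<Rightarrow> nat \<Rightarrow> real \<Rightarrow> (nat \<Rightarrow> bool list) \<Rightarrow> (nat \<Rightarrow> bool list) \<Rightarrow> bool" where
  "accepts l k r t f g \<longleftrightarrow>
     closeness_statistic (cube l) {..<k} {k..<k + r} {k + r..<k + 2 * r} f g \<le> t"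

lemma accepts_cong:
  assumes "\<And>i. i < k + 2 * r \<Longrightarrow> f i = f' i" "\<And>i. i < k + 2 * r \<Longrightarrow> g i = g' i"
  shows "accepts l k r t f g = accepts l k r t f' g'"
  unfolding accepts_def closeness_statistic_def
  by (intro arg_cong[where f = "\<lambda>x. x \<le> t"] sum.cong refl arg_cong2[where f = "(*)"] weight_cong count_diff_cong)
    (auto intro!: assms)

definition positions_list :: "nat \<Rightarrow> nat \<Rightarrow> (nat \<Rightarrow> nat) \<Rightarrow> (source \<times> nat \<times> nat) list" where
  "positions_list s l J = List.product [FromX, FromY] (List.product [0..<s] (map J [0..<l]))"

definition tester_tree :: "nat \<Rightarrow> nat \<Rightarrow> nat \<Rightarrow> real \<Rightarrow> (nat \<Rightarrow> nat) \<Rightarrow> query_tree" where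
  "tester_tree l k r t J = decision_tree (positions_list (k + 2 * r) l J)
     (\<lambda>xs ys. accepts l k r t (restrict_to l J \<circ> xs) (restrict_to l J \<circ> ys))"

definition tester :: "nat \<Rightarrow> nat \<Rightarrow> nat \<Rightarrow> nat \<Rightarrow> real \<Rightarrow> query_tree pmf" where
  "tester n l k r t = map_pmf (tester_tree l k r t) (random_positions n l)"

lemma verdict_tester_tree:
  "verdict (tester_tree l k r t J) xs ys =
    accepts l k r t (restrict_to l J \<circ> xs) (restrict_to l J \<circ> ys)"
  unfolding tester_tree_def
proof (rule verdict_decision_tree, rule accepts_cong)
  fix xs' ys' j
  assume bits: "\<And>b. b \<in> set (positions_list (k + 2 * r) l J) \<Longrightarrow> bit_of b xs' ys' = bit_of b xs ys"
    and j: "j < k + 2 * r"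
  have "bit_of (c, j, J i) xs' ys' = bit_of (c, j, J i) xs ys" if "i < l" for c i
    using that j by (intro bits) (cases c; force simp: positions_list_def)
  from this[of _ FromX] this[of _ FromY]
  show "(restrict_to l J \<circ> xs') j = (restrict_to l J \<circ> xs) j"
    and "(restrict_to l J \<circ> ys') j = (restrict_to l J \<circ> ys) j"
    by (auto simp: restrict_to_def bit_of_def)
qed

lemma uses_at_most_tester:
  assumes "0 < n"
  shows "uses_at_most n (k + 2 * r) (2 * (k + 2 * r) * l) (tester n l k r t)"
  unfolding uses_at_most_def
proof
  fix T assume "T \<in> set_pmf (tester n l k r t)"
  then obtain J where J: "J \<in> set_pmf (random_positions n l)" and T: "T = tester_tree l k r t J"
    by (auto simp: tester_def)
  have "well_formed n (k + 2 * r) T"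
    unfolding T tester_tree_def decision_tree_def
    by (rule well_formed_read_tree) (auto simp: positions_list_def random_positions_less[OF assms J])
  moreover have "max_queries T = 2 * (k + 2 * r) * l"
    by (simp add: T tester_tree_def decision_tree_def max_queries_read_tree positions_list_def algebra_simps)
  ultimately show "well_formed n (k + 2 * r) T \<and> max_queries T \<le> 2 * (k + 2 * r) * l" by simp
qed

text \<open>Restriction commutes with independent sampling: given the positions, the test sees
  i.i.d. samples of the restricted distributions. The default value \<open>[]\<close> is restricted
  as well, hence \<open>restrict_to l J []\<close>.\<close>

lemma run_tester:
  fixes X Y :: "bool list pmf"
  defines "P \<equiv> \<lambda>s l J X. Pi_pmf {..<s} (restrict_to l J []) (\<lambda>_. map_pmf (restrict_to l J) X)"
  shows "run (tester n l k r t) (k + 2 * r) X Y =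
    bind_pmf (random_positions n l) (\<lambda>J. map_pmf (\<lambda>(f, g). accepts l k r t f g)
      (pair_pmf (P (k + 2 * r) l J X) (P (k + 2 * r) l J Y)))"
proof -
  have P: "P s l J X = map_pmf (\<lambda>h. restrict_to l J \<circ> h) (Pi_pmf {..<s} [] (\<lambda>_. X))" for s l J and X :: "bool list pmf"
    unfolding P_def by (rule Pi_pmf_map) auto
  show ?thesis
    unfolding run_def tester_def P
    by (simp add: bind_map_pmf verdict_tester_tree map_pair[symmetric] pmf.map_comp comp_def split_def)
      (simp add: map_pmf_def pair_pmf_def bind_assoc_pmf bind_return_pmf)
qed

text \<open>\<open>D\<^sub>0\<close> is chosen such that
  \<open>5 * m * D\<^sub>0 = (\<epsilon> / 4)^2\<close>, where \<open>5 * m\<close> bounds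
  \<open>card S + 2 * k\<close>. Identical distributions have identical restrictions for every
  choice of positions, so acceptance has probability at least \<open>81 / 100\<close>; in the far
  case the positions cost another \<open>1 / 10\<close>, and \<open>729 / 1000\<close> still exceeds
  \<open>2 / 3\<close>.\<close>

lemma tester_distinguishes:
  assumes n: "0 < n" and \<epsilon>: "0 < \<epsilon>" "\<epsilon> < 1" and m: "0 < m" and k: "k \<le> 2 * m" and r: "0 < r"
    and l: "real m * (1 - \<epsilon> / 2) ^ l \<le> \<epsilon> / 40"
  defines "D\<^sub>0 \<equiv> \<epsilon>\<^sup>2 / (80 * real m)"
  assumes D\<^sub>0: "312500 / real (Suc k) \<le> (real r * D\<^sub>0)\<^sup>2"
  shows "distinguishes n \<epsilon> (k + 2 * r) (\<lambda>X Y. card (set_pmf X) \<le> m \<or> card (set_pmf Y) \<le> m)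
    (tester n l k r (real r ^ 2 * D\<^sub>0 / 2))"
  unfolding distinguishes_def
proof (intro allI impI conjI)
  fix X Y :: "bool list pmf"
  assume X: "set_pmf X \<subseteq> cube n" and Y: "set_pmf Y \<subseteq> cube n"
    and small: "card (set_pmf X) \<le> m \<or> card (set_pmf Y) \<le> m"
  let ?t = "real r ^ 2 * D\<^sub>0 / 2"
  define p where "p = (\<lambda>J. map_pmf (restrict_to l J) X)"
  define q where "q = (\<lambda>J. map_pmf (restrict_to l J) Y)"
  define M where "M J = pair_pmf (Pi_pmf {..<k + 2 * r} (restrict_to l J []) (\<lambda>_. p J))
    (Pi_pmf {..<k + 2 * r} (restrict_to l J []) (\<lambda>_. q J))" for J
  have D\<^sub>0_pos: "0 < D\<^sub>0" using \<epsilon> m by (simp add: D\<^sub>0_def)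
  have I: "{..<k + 2 * r} = {..<k} \<union> ({k..<k + r} \<union> {k + r..<k + 2 * r})" by auto
  have p: "set_pmf (p J) \<subseteq> cube l" and q: "set_pmf (q J) \<subseteq> cube l" for J
    by (auto simp: p_def q_def restrict_to_in_cube)
  have run: "pmf (run (tester n l k r ?t) (k + 2 * r) X Y) b = measure_pmf.prob
      (bind_pmf (random_positions n l) (\<lambda>J. map_pmf (\<lambda>(f, g). accepts l k r ?t f g) (M J))) {b}" for b
    unfolding run_tester M_def p_def q_def by (simp add: measure_pmf_single)
  have fin: "finite (set_pmf (random_positions n l))"
    by (rule finite_random_positions[OF n])
  have D\<^sub>0': "312500 / real (Suc (card {..<k})) \<le> (real r * D\<^sub>0)\<^sup>2" using D\<^sub>0 by simp
  have dis: "{..<k} \<inter> {k..<k + r} = {}" "{..<k} \<inter> {k + r..<k + 2 * r} = {}"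
      "{k..<k + r} \<inter> {k + r..<k + 2 * r} = {}"
    and card: "card {k..<k + r} = r" "card {k + r..<k + 2 * r} = r"
    by auto
  note test = closeness_test[where A = "cube l" and p = "p J" and q = "q J" and r = r and D\<^sub>0 = D\<^sub>0
      and I\<^sub>0 = "{..<k}" and I\<^sub>1 = "{k..<k + r}" and I\<^sub>2 = "{k + r..<k + 2 * r}"
      and d = "restrict_to l J []" and e = "restrict_to l J []" for J,
      OF finite_cube p q finite_lessThan finite_atLeastLessThan finite_atLeastLessThan dis card r D\<^sub>0_pos D\<^sub>0', folded I, folded M_def]
  show "2 / 3 \<le> pmf (run (tester n l k r ?t) (k + 2 * r) X Y) True" if "X = Y"
  proof -
    have "81 / 100 \<le> measure_pmf.prob (map_pmf (\<lambda>(f, g). accepts l k r ?t f g) (M J)) {True}" for J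
      using test(1)[of J] that by (simp add: p_def q_def accepts_def vimage_def split_def)
    then have "(1 - 0) * (81 / 100) \<le> pmf (run (tester n l k r ?t) (k + 2 * r) X Y) True"
      unfolding run by (intro prob_bind_ge[where G = UNIV] fin) auto
    then show ?thesis by simp
  qed
  show "2 / 3 \<le> pmf (run (tester n l k r ?t) (k + 2 * r) X Y) False" if far: "eps_far n \<epsilon> X Y"
  proof -
    have sep: "1 - 1 / 10 \<le> measure_pmf.prob (random_positions n l) {J. separated l m (\<epsilon> / 4) (p J) (q J)}"
      using restriction_separates[OF n \<epsilon> X Y small far l] by (simp add: p_def q_def)
    have "81 / 100 \<le> measure_pmf.prob (map_pmf (\<lambda>(f, g). accepts l k r ?t f g) (M J)) {False}"
      if "separated l m (\<epsilon> / 4) (p J) (q J)" for J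
    proof -
      from that obtain S where S: "S \<subseteq> cube l" "card S \<le> m"
        "\<epsilon> / 4 \<le> (\<Sum>c\<in>S. \<bar>pmf (p J) c - pmf (q J) c\<bar>)"
        by (auto simp: separated_def)
      have "S \<noteq> {}" using S(3) \<epsilon> by auto
      then have "0 < card S" using S(1) finite_cube finite_subset by (auto simp: card_gt_0_iff)
      have "real (card S) + 2 * real k \<le> 5 * real m" using S(2) k by linarith
      then have "D\<^sub>0 * (real (card S) + 2 * real k) \<le> D\<^sub>0 * (5 * real m)"
        using D\<^sub>0_pos by (intro mult_left_mono) auto
      also have "\<dots> = (\<epsilon> / 4)\<^sup>2" using m by (simp add: D\<^sub>0_def power2_eq_square)
      also have "\<dots> \<le> (\<Sum>c\<in>S. \<bar>pmf (p J) c - pmf (q J) c\<bar>)\<^sup>2"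
        using S(3) \<epsilon> by (intro power_mono) auto
      finally show ?thesis
        using test(2)[of S J] S(1) \<open>0 < card S\<close> by (simp add: accepts_def vimage_def split_def)
    qed
    then have "(1 - 1 / 10) * (81 / 100) \<le> pmf (run (tester n l k r ?t) (k + 2 * r) X Y) False"
      unfolding run by (intro prob_bind_ge[OF fin sep]) auto
    then show ?thesis by simp
  qed
qed

section \<open>Degenerate cases and choice of parameters\<close>

lemma trivial_tester:
  assumes "\<And>X Y. set_pmf X \<subseteq> cube n \<Longrightarrow> set_pmf Y \<subseteq> cube n \<Longrightarrow> P X Y \<Longrightarrow> \<not> eps_far n \<epsilon> X Y"
  shows "distinguishes n \<epsilon> 0 P (return_pmf (Answer True))" "uses_at_most n 0 0 (return_pmf (Answer True))"
  using assms by (auto simp: distinguishes_def uses_at_most_def run_def bind_return_pmf)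

text \<open>The sample sizes balance through \<open>M ^ 3 = m^2\<close>: with \<open>r\<close> about
  \<open>50000 * M / \<epsilon>^2\<close>, \<open>r * D\<^sub>0\<close> is about
  \<open>625 * M / m\<close>, whose square is \<open>390625 / M\<close>. The value of
  \<open>l\<close> makes \<open>exp (- \<epsilon> * l / 2)\<close> at most
  \<open>\<epsilon> / (40 * m)\<close>.\<close>

lemma tester_parameters:
  fixes m :: nat and \<epsilon> :: real
  assumes m: "0 < m" and \<epsilon>: "0 < \<epsilon>" "\<epsilon> < 1"
  defines "M \<equiv> real m powr (2/3)"
  defines "k \<equiv> nat \<lceil>M\<rceil>" and "r \<equiv> nat \<lceil>50000 * (M / \<epsilon>\<^sup>2)\<rceil>" and "l \<equiv> nat \<lceil>2 / \<epsilon> * ln (40 * real m / \<epsilon>)\<rceil>"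
  shows "k \<le> 2 * m" "0 < r" "real m * (1 - \<epsilon> / 2) ^ l \<le> \<epsilon> / 40"
    "312500 / real (Suc k) \<le> (real r * (\<epsilon>\<^sup>2 / (80 * real m)))\<^sup>2"
    "real (k + 2 * r) \<le> 10 ^ 7 * (M / \<epsilon>\<^sup>2)"
    "real (2 * (k + 2 * r) * l) \<le> soft_bound (10 ^ 7) 1 (M / \<epsilon> ^ 3)"
proof -
  have m1: "1 \<le> real m" using m by simp
  have M1: "1 \<le> M" using m1 by (simp add: M_def ge_one_powr_ge_zero)
  have M3: "M ^ 3 = (real m)\<^sup>2"
  proof -
    have "M ^ 3 = M powr 3" using M1 by (subst powr_realpow[symmetric]) auto
    also have "\<dots> = real m powr 2" by (simp add: M_def powr_powr)
    finally show ?thesis using m1 by (simp add: powr_numeral)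
  qed
  have "M \<le> real m powr 1" unfolding M_def using m1 by (intro powr_mono) auto
  then have Mm: "M \<le> real m" by simp
  show "k \<le> 2 * m" using Mm unfolding k_def by linarith
  define F where "F = M / \<epsilon>\<^sup>2"
  have e2: "0 < \<epsilon>\<^sup>2" "\<epsilon>\<^sup>2 \<le> 1" using \<epsilon> by (auto simp: power_le_one)
  have MF: "M \<le> F" using M1 e2 by (simp add: F_def pos_le_divide_eq mult_left_le)
  have F1: "1 \<le> F" using M1 MF by linarith
  have rF: "50000 * F \<le> real r" "real r \<le> 50000 * F + 1"
    unfolding r_def F_def[symmetric] using F1 by linarith+
  have kM: "M \<le> real k" "real k \<le> M + 1" unfolding k_def using M1 by linarith+
  show "0 < r" using rF F1 by (cases r) auto
  \<comment> \<open>Beyond \<open>100000 * F\<close>, this covers \<open>M\<close> and the three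
    units lost to rounding, each at most \<open>F\<close>.\<close>
  have s: "real (k + 2 * r) \<le> 100004 * F" using rF kM MF F1 by simp
  then show "real (k + 2 * r) \<le> 10 ^ 7 * (M / \<epsilon>\<^sup>2)" using F1 by (simp add: F_def[symmetric])
  show "312500 / real (Suc k) \<le> (real r * (\<epsilon>\<^sup>2 / (80 * real m)))\<^sup>2"
  proof -
    have "312500 / real (Suc k) \<le> 312500 / M"
      using kM M1 by (intro divide_left_mono) auto
    also have "\<dots> \<le> 390625 / M" using M1 by (intro divide_right_mono) auto
    also have "\<dots> = 390625 * M\<^sup>2 / M ^ 3" using M1 by (simp add: power2_eq_square power3_eq_cube)
    also have "\<dots> = (50000 * F * (\<epsilon>\<^sup>2 / (80 * real m)))\<^sup>2"
      unfolding M3 using \<epsilon> m1 by (simp add: F_def power_divide power_mult_distrib field_simps)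
    also have "\<dots> \<le> (real r * (\<epsilon>\<^sup>2 / (80 * real m)))\<^sup>2"
      using rF F1 m1 by (intro power_mono mult_right_mono) auto
    finally show ?thesis .
  qed
  define L where "L = ln (40 * real m / \<epsilon>)"
  have pos: "0 < 40 * real m / \<epsilon>" using m1 \<epsilon> by simp
  have "1 \<le> 40 * real m / \<epsilon>" using m1 \<epsilon> by (simp add: pos_le_divide_eq)
  then have L0: "0 \<le> L" unfolding L_def by simp
  have l: "2 / \<epsilon> * L \<le> real l" "real l \<le> 2 / \<epsilon> * L + 1"
  proof -
    have "0 \<le> 2 / \<epsilon> * L" using L0 \<epsilon> by simp
    then show "2 / \<epsilon> * L \<le> real l" "real l \<le> 2 / \<epsilon> * L + 1"
      unfolding l_def L_def[symmetric] by linarith+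
  qed
  show "real m * (1 - \<epsilon> / 2) ^ l \<le> \<epsilon> / 40"
  proof -
    have "1 - \<epsilon> / 2 \<le> exp (- (\<epsilon> / 2))" using exp_ge_add_one_self[of "- (\<epsilon> / 2)"] by simp
    then have "(1 - \<epsilon> / 2) ^ l \<le> exp (- (\<epsilon> / 2)) ^ l" using \<epsilon> by (intro power_mono) auto
    also have "\<dots> = exp (- (\<epsilon> / 2 * real l))" by (simp add: exp_of_nat_mult[symmetric] mult.commute)
    also have "\<dots> \<le> exp (- L)"
      using mult_left_mono[OF l(1), of "\<epsilon> / 2"] \<epsilon> by simp
    also have "\<dots> = \<epsilon> / (40 * real m)" using pos by (simp add: L_def exp_minus)
    finally have "real m * (1 - \<epsilon> / 2) ^ l \<le> real m * (\<epsilon> / (40 * real m))"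
      by (rule mult_left_mono) simp
    then show ?thesis using m1 by simp
  qed
  define f where "f = M / \<epsilon> ^ 3"
  define \<Lambda> where "\<Lambda> = ln (2 + f)"
  have e3: "0 < \<epsilon> ^ 3" "\<epsilon> ^ 3 \<le> 1" using \<epsilon> by (auto simp: power_le_one)
  have Mf: "M \<le> f" using M1 e3 by (simp add: f_def pos_le_divide_eq mult_left_le)
  have f1: "1 \<le> f" using M1 Mf by linarith
  have "exp 1 \<le> 2 + f" using exp_le f1 by linarith
  then have \<Lambda>1: "1 \<le> \<Lambda>" unfolding \<Lambda>_def using f1 by (simp add: ln_ge_iff)
  \<comment> \<open>The logarithm has to be expressed through \<open>f\<close>. From
    \<open>m^2 = M ^ 3\<close> follows \<open>m \<le> M^2\<close>, hence
    \<open>m / \<epsilon> \<le> f^2\<close>; together with \<open>40 \<le> 3 ^ 4\<close> the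
    argument is at most \<open>(2 + f) ^ 6\<close>.\<close>
  have "L \<le> 6 * \<Lambda>"
  proof -
    have "(real m)\<^sup>2 \<le> (M\<^sup>2)\<^sup>2"
      using M1 by (simp add: M3[symmetric] power_mult[symmetric] power_increasing)
    then have mM: "real m \<le> M\<^sup>2" by (rule power2_le_imp_le) simp
    have "real m / \<epsilon> \<le> M\<^sup>2 / \<epsilon> ^ 6"
      using mM \<epsilon> power_decreasing[of 1 6 \<epsilon>] by (intro frac_le) auto
    also have "\<dots> = f\<^sup>2" by (simp add: f_def power_divide)
    also have "\<dots> \<le> (2 + f)\<^sup>2" using f1 by (intro power_mono) auto
    finally have me: "real m / \<epsilon> \<le> (2 + f)\<^sup>2" .
    have "(3 :: real) ^ 4 \<le> (2 + f) ^ 4" using f1 by (intro power_mono) auto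
    then have "40 * (real m / \<epsilon>) \<le> (2 + f) ^ 4 * (2 + f)\<^sup>2"
      using me m1 \<epsilon> by (intro mult_mono) auto
    also have "\<dots> = (2 + f) ^ 6" by (simp add: power_add[symmetric])
    finally have "L \<le> ln ((2 + f) ^ 6)" unfolding L_def using pos by (intro ln_mono) auto
    then show ?thesis using f1 by (simp add: \<Lambda>_def ln_realpow)
  qed
  have l13: "real l \<le> 13 * \<Lambda> / \<epsilon>"
  proof -
    have "2 / \<epsilon> * L \<le> 2 / \<epsilon> * (6 * \<Lambda>)" using \<open>L \<le> 6 * \<Lambda>\<close> \<epsilon> by (intro mult_left_mono) auto
    moreover have "1 \<le> \<Lambda> / \<epsilon>" using \<Lambda>1 \<epsilon> by (simp add: pos_le_divide_eq)
    moreover have "2 / \<epsilon> * (6 * \<Lambda>) = 12 * (\<Lambda> / \<epsilon>)" "13 * \<Lambda> / \<epsilon> = 13 * (\<Lambda> / \<epsilon>)" by simp_all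
    ultimately show ?thesis using l(2) by linarith
  qed
  have "real (2 * (k + 2 * r) * l) = 2 * real (k + 2 * r) * real l" by simp
  also have "\<dots> \<le> 2 * (100004 * F) * (13 * \<Lambda> / \<epsilon>)"
    using s l13 F1 by (intro mult_mono) auto
  also have "\<dots> = 2600104 * (f * \<Lambda>)"
    by (simp add: F_def f_def power2_eq_square power3_eq_cube)
  also have "\<dots> \<le> 10 ^ 7 * (f * \<Lambda>)" using f1 \<Lambda>1 by (intro mult_right_mono) auto
  finally show "real (2 * (k + 2 * r) * l) \<le> soft_bound (10 ^ 7) 1 (M / \<epsilon> ^ 3)"
    by (simp add: soft_bound_def f_def \<Lambda>_def)
qed

text \<open>No far pair satisfies the promise if \<open>m = 0\<close> (supports are nonempty),
  \<open>n = 0\<close> or \<open>\<epsilon> \<ge> 1\<close>; then the constant answer works with no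
  samples, as it must for \<open>m = 0\<close>, where both bounds are 0. Otherwise positions exist
  and the parameter estimates apply.\<close>

lemma exists_tester:
  fixes m n :: nat and \<epsilon> :: real
  assumes "0 < \<epsilon>"
  shows "\<exists>s q A. real s \<le> 10 ^ 7 * (real m powr (2/3) / \<epsilon>^2) \<and>
    real q \<le> soft_bound (10 ^ 7) 1 (real m powr (2/3) / \<epsilon>^3) \<and> uses_at_most n s q A \<and>
    distinguishes n \<epsilon> s (\<lambda>X Y. card (set_pmf X) \<le> m \<or> card (set_pmf Y) \<le> m) A"
proof (cases "m = 0 \<or> n = 0 \<or> 1 \<le> \<epsilon>")
  case True
  have trivial: "\<not> eps_far n \<epsilon> X Y"
    if X: "set_pmf X \<subseteq> cube n" and Y: "set_pmf Y \<subseteq> cube n"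
      and small: "card (set_pmf X) \<le> m \<or> card (set_pmf Y) \<le> m" for X Y
    using True
  proof (elim disjE)
    assume "m = 0"
    then have False
      using small finite_subset[OF X finite_cube] finite_subset[OF Y finite_cube] by (auto simp: set_pmf_not_empty)
    then show ?thesis ..
  next
    assume "n = 0"
    then show ?thesis using emd_0_le_0[of X Y] X Y assms by (simp add: eps_far_def)
  next
    assume "1 \<le> \<epsilon>"
    then show ?thesis using emd_le_1[OF X Y] by (simp add: eps_far_def)
  qed
  have "0 \<le> soft_bound (10 ^ 7) 1 (real m powr (2/3) / \<epsilon>^3)"
    using assms by (auto simp: soft_bound_def intro!: mult_nonneg_nonneg ln_ge_zero)
  with trivial_tester[OF trivial] assms show ?thesis
    by (intro exI[of _ "0 :: nat"] exI[of _ "return_pmf (Answer True)"]) auto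
next
  case False
  then have m: "0 < m" and n: "0 < n" and \<epsilon>: "\<epsilon> < 1" by auto
  note par = tester_parameters[OF m assms \<epsilon>]
  show ?thesis
    using par(5,6) uses_at_most_tester[OF n] tester_distinguishes[OF n assms \<epsilon> m par(1-4)] by blast
qed

theorem theorem5p2:
  "(\<exists>(C::real) (k::nat). \<forall>(m::nat) (n::nat) (\<epsilon>::real). \<epsilon> > 0 \<longrightarrow>
      (\<exists>(s::nat) (q::nat) A.
         real s \<le> C * (real m powr (2/3) / \<epsilon>^2) \<and>
         real q \<le> soft_bound C k (real m powr (2/3) / \<epsilon>^3) \<and>
         uses_at_most n s q A \<and>
         distinguishes n \<epsilon> s
           (\<lambda>X Y. card (set_pmf X) \<le> m \<and> card (set_pmf Y) \<le> m) A)) \<and>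
   (\<exists>(C::real) (k::nat). \<forall>(m::nat) (n::nat) (\<epsilon>::real). \<epsilon> > 0 \<longrightarrow>
      (\<exists>(s::nat) (q::nat) A.
         real s \<le> C * (real m powr (2/3) / \<epsilon>^2) \<and>
         real q \<le> soft_bound C k (real m powr (2/3) / \<epsilon>^3) \<and>
         uses_at_most n s q A \<and>
         distinguishes n \<epsilon> s
           (\<lambda>X Y. card (set_pmf X) \<le> m \<or> card (set_pmf Y) \<le> m) A))"
proof -
  \<comment> \<open>The two-sided promise is stronger than the one-sided one, so the same tester
    serves both claims.\<close>
  have weaken: "distinguishes n \<epsilon> s (\<lambda>X Y. card (set_pmf X) \<le> m \<or> card (set_pmf Y) \<le> m) A \<Longrightarrow>
      distinguishes n \<epsilon> s (\<lambda>X Y. card (set_pmf X) \<le> m \<and> card (set_pmf Y) \<le> m) A" for n \<epsilon> s m A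
    unfolding distinguishes_def by blast
  show ?thesis
    by (rule conjI; rule exI[of _ "10 ^ 7"], rule exI[of _ 1], use exists_tester weaken in blast)
qed

end
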